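(* Let $\lambda\in\mathbb{R}\setminus\{0\}$, $a,b\in\mathbb{R}$, and let $\mathcal{H}_{\lambda,a,b}\subset M_{3\times3}(\mathbb{R})\oplus M_{3\times3}(\mathbb{R})$ be the space of invariant nearly half-flat structures on $S^3\times S^3$, described as the set of pairs $(Q,P)$ given in the context. Then, modulo equivalence (the action of $SO(3)\times SO(3)$ described in the context), $\mathcal{H}_{\lambda,a,b}$ is a subset of the singular symplectic quotient $\mu^{-1}(0)/SO(4)$: the map $(Q,P)\mapsto(\Phi(Q),\Phi(P))$ sends $\mathcal{H}_{\lambda,a,b}$ into $\mu^{-1}(0)$ and induces an injection of $\mathcal{H}_{\lambda,a,b}/(SO(3)\times SO(3))$ into $\mu^{-1}(0)/SO(4)$. Moreover $$\frac{\mu^{-1}(0)}{SO(4)}\cong\frac{\mathbb{R}^3\oplus\mathbb{R}^3}{S_3}$$ (homeomorphism), where $S_3$ acts by simultaneously permuting the coordinates of the two copies of $\mathbb{R}^3$.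
   Context: $\mathrm{Adj}(X)$ is the classical adjugate, so $X\,\mathrm{Adj}(X)=\det(X)\mathrm{Id}$. $\mathcal{H}_{\lambda,a,b}$ is the set of $(Q,P)$ with $\det P\ne0$, $Q^TP=P^TQ$, $QP^T=PQ^T$ and $$(\det P)^2=-(ab-\mathrm{tr}(Q_1^TQ_2))^2-4(a\det Q_2+b\det Q_1)+4\,\mathrm{tr}(\mathrm{Adj}(Q_1^TQ_2)),$$ where $Q_1=Q-\frac\lambda2\mathrm{Adj}(P^T)$ and $Q_2=-Q-\frac\lambda2\mathrm{Adj}(P^T)$. The pair $(Q,P)$ corresponds to the left-invariant pair of forms on $S^3\times S^3$ $$\omega=\sum P_{ij}e^{2i-1}\wedge e^{2j},\qquad \gamma=ae^{135}+be^{246}+\sum\big((Q_1)_{ij}de^{2i-1}\wedge e^{2j}+(Q_2)_{ij}e^{2i-1}\wedge de^{2j}\big),$$ where $e^1,\dots,e^6$ is the left-invariant coframe with $de^1=e^{35}$, $de^3=-e^{15}$, $de^5=e^{13}$, $de^2=e^{46}$, $de^4=-e^{26}$, $de^6=e^{24}$. $SO(3)\times SO(3)$ acts on pairs by $(g,h)\cdot(Q,P)=(gQh^T,gPh^T)$. $V$ denotes the space of real symmetric trace-free $4\times4$ matrices, on which $SO(4)$ acts by conjugation; $SO(4)$ acts diagonally on $V\oplus V\cong T^*V$. The moment map is $\mu:V\oplus V\to\mathfrak{so}(4)$, $\mu(A,B)=[A,B]=AB-BA$. $\Phi:M_{3\times3}(\mathbb{R})\to V$ is the linear isomorphism $\Phi(X)=\sum_{i,j=1}^3X_{ij}L_iR_j$,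 where $\mathbb{R}^4$ is identified with the quaternions and $L_i,R_j$ are the endomorphisms $v\mapsto u_iv$, $v\mapsto vu_j$ with $(u_1,u_2,u_3)=(\mathbf{i},\mathbf{j},\mathbf{k})$. It is equivariant with respect to the double cover $SO(4)\to SO(3)\times SO(3)$ that sends the rotation $v\mapsto pvq^{-1}$ ($p,q$ unit quaternions) to the pair of rotations of $\mathrm{span}(\mathbf{i},\mathbf{j},\mathbf{k})$ given by conjugation by $p$ and by $q$. *)

theory Defs
  imports "HOL-Analysis.Analysis" "HOL-Algebra.Group_Action"
begin

section \<open>Orbit spaces\<close>

definition orbit_space ::
    "('g, 'm) monoid_scheme \<Rightarrow> 'x::topological_space set \<Rightarrow> ('g \<Rightarrow> 'x \<Rightarrow> 'x) \<Rightarrow> 'x set topology"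
  where "orbit_space G E \<phi> =
    topology (\<lambda>U. U \<subseteq> orbits G E \<phi> \<and> openin (top_of_set E) {x \<in> E. orbit G \<phi> x \<in> U})"

lemma openin_orbit_space:
  "openin (orbit_space G E \<phi>) U \<longleftrightarrow>
     U \<subseteq> orbits G E \<phi> \<and> openin (top_of_set E) {x \<in> E. orbit G \<phi> x \<in> U}"
proof -
  have "istopology (\<lambda>U. U \<subseteq> orbits G E \<phi> \<and> openin (top_of_set E) {x \<in> E. orbit G \<phi> x \<in> U})"
    (is "istopology ?L")
    unfolding istopology_def
  proof (intro conjI allI impI)
    fix S T assume "?L S" "?L T"
    moreover have "{x \<in> E. orbit G \<phi> x \<in> S \<inter> T}
        = {x \<in> E. orbit G \<phi> x \<in> S} \<inter> {x \<in> E. orbit G \<phi> x \<in> T}" by auto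
    ultimately show "S \<inter> T \<subseteq> orbits G E \<phi>"
      and "openin (top_of_set E) {x \<in> E. orbit G \<phi> x \<in> S \<inter> T}" by auto
  next
    fix K assume K: "\<forall>U\<in>K. ?L U"
    then show "\<Union> K \<subseteq> orbits G E \<phi>" by auto
    have "{x \<in> E. orbit G \<phi> x \<in> \<Union> K} = (\<Union>U\<in>K. {x \<in> E. orbit G \<phi> x \<in> U})" by auto
    with K show "openin (top_of_set E) {x \<in> E. orbit G \<phi> x \<in> \<Union> K}" by auto
  qed
  then show ?thesis by (simp add: orbit_space_def)
qed

lemma topspace_orbit_space: "topspace (orbit_space G E \<phi>) = orbits G E \<phi>"
proof (rule antisym)
  show "topspace (orbit_space G E \<phi>) \<subseteq> orbits G E \<phi>"
    by (metis openin_orbit_space openin_topspace)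
  have "{x \<in> E. orbit G \<phi> x \<in> orbits G E \<phi>} = E" by (auto simp: orbits_def)
  then have "openin (orbit_space G E \<phi>) (orbits G E \<phi>)"
    using openin_topspace[of "top_of_set E"] by (simp add: openin_orbit_space)
  then show "orbits G E \<phi> \<subseteq> topspace (orbit_space G E \<phi>)" by (rule openin_subset)
qed

lemma quotient_map_orbit_space:
  "quotient_map (top_of_set E) (orbit_space G E \<phi>) (orbit G \<phi>)"
  by (auto simp: quotient_map_def topspace_orbit_space openin_orbit_space orbits_def)


section \<open>Matrices\<close>

definition SO :: "(real^'n^'n) monoid"
  where "SO = \<lparr>carrier = {A. rotation_matrix A}, mult = (**), one = mat 1\<rparr>"

text \<open>The \<open>(i, j)\<close> entry of the adjugate is the \<open>(j, i)\<close> cofactor, that is, the determinant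
  of \<open>X\<close> with its \<open>j\<close>-th row replaced by the \<open>i\<close>-th unit vector.\<close>

definition Adj :: "real^'n^'n \<Rightarrow> real^'n^'n"
  where "Adj X = (\<chi> i j. det (\<chi> k. if k = j then axis i 1 else row k X))"

lemma matrix_mult_Adj: "X ** Adj X = mat (det X)"
proof -
  have "(X ** Adj X) $ i $ j = mat (det X) $ i $ j" for i j
  proof -
    have "(X ** Adj X) $ i $ j
        = (\<Sum>k\<in>UNIV. det (\<chi> l. if l = j then X $ i $ k *s axis k 1 else row l X))"
      by (simp add: matrix_matrix_mult_def Adj_def det_row_mul[where c = "X $ i $ _"])
    also have "\<dots> = det (\<chi> l. if l = j then (\<Sum>k\<in>UNIV. X $ i $ k *s axis k 1) else row l X)"
      by (rule det_linear_row_sum[symmetric]) simp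
    also have "\<dots> = det (\<chi> l. if l = j then row i X else row l X)"
      by (simp only: basis_expansion row_def vec_lambda_eta)
    also have "\<dots> = mat (det X) $ i $ j"
    proof (cases "i = j")
      case True
      have "(\<chi> l. if l = j then row i X else row l X) = X"
        using True by (auto simp: vec_eq_iff row_def)
      then show ?thesis using True by (simp only: mat_def) simp
    next
      case False
      have "det (\<chi> l. if l = j then row i X else row l X) = 0"
        by (rule det_identical_rows[OF False]) (use False in \<open>auto simp: row_def vec_eq_iff\<close>)
      then show ?thesis using False by (simp add: mat_def)
    qed
    finally show ?thesis .
  qed
  then show ?thesis by (simp add: vec_eq_iff)
qed


section \<open>Invariant nearly half-flat structures on \<open>S\<^sup>3 \<times> S\<^sup>3\<close>\<close>

text \<open>With \<open>e\<^sup>1, \<dots>, e\<^sup>6\<close> the left-invariant coframe with \<open>de\<^sup>1 = e\<^sup>3\<^sup>5\<close>, \<open>de\<^sup>3 = -e\<^sup>1\<^sup>5\<close>,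
  \<open>de\<^sup>5 = e\<^sup>1\<^sup>3\<close>, \<open>de\<^sup>2 = e\<^sup>4\<^sup>6\<close>, \<open>de\<^sup>4 = -e\<^sup>2\<^sup>6\<close>, \<open>de\<^sup>6 = e\<^sup>2\<^sup>4\<close>, the pair \<open>(Q, P)\<close> encodes
  the 2-form with coefficients \<open>P\<^sub>i\<^sub>j\<close> along \<open>e\<^bsup>2i-1\<^esup> \<and> e\<^bsup>2j\<^esup>\<close> and the 3-form with coefficients
  \<open>a\<close>, \<open>b\<close>, \<open>(Q\<^sub>1)\<^sub>i\<^sub>j\<close>, \<open>(Q\<^sub>2)\<^sub>i\<^sub>j\<close> along \<open>e\<^sup>1\<^sup>3\<^sup>5\<close>, \<open>e\<^sup>2\<^sup>4\<^sup>6\<close>, \<open>de\<^bsup>2i-1\<^esup> \<and> e\<^bsup>2j\<^esup>\<close>,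
  \<open>e\<^bsup>2i-1\<^esup> \<and> de\<^bsup>2j\<^esup>\<close>. The real parameter \<open>lam\<close> is the constant of the nearly half-flat
  condition.\<close>

definition Q1 :: "real \<Rightarrow> real^3^3 \<Rightarrow> real^3^3 \<Rightarrow> real^3^3"
  where "Q1 lam Q P = Q - (lam / 2) *\<^sub>R Adj (transpose P)"

definition Q2 :: "real \<Rightarrow> real^3^3 \<Rightarrow> real^3^3 \<Rightarrow> real^3^3"
  where "Q2 lam Q P = - Q - (lam / 2) *\<^sub>R Adj (transpose P)"

definition nearly_half_flat :: "real \<Rightarrow> real \<Rightarrow> real \<Rightarrow> ((real^3^3) \<times> (real^3^3)) set"
  where "nearly_half_flat lam a b = {(Q, P).
    det P \<noteq> 0 \<and>
    transpose Q ** P = transpose P ** Q \<and>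
    Q ** transpose P = P ** transpose Q \<and>
    (det P)\<^sup>2 =
      - (a * b - trace (transpose (Q1 lam Q P) ** Q2 lam Q P))\<^sup>2
      - 4 * (a * det (Q2 lam Q P) + b * det (Q1 lam Q P))
      + 4 * trace (Adj (transpose (Q1 lam Q P) ** Q2 lam Q P))}"

fun act33 :: "(real^3^3) \<times> (real^3^3) \<Rightarrow> (real^3^3) \<times> (real^3^3) \<Rightarrow> (real^3^3) \<times> (real^3^3)"
  where "act33 (g, h) (Q, P) = (g ** Q ** transpose h, g ** P ** transpose h)"


section \<open>The moment map on \<open>T\<^sup>*V\<close>\<close>

definition V :: "(real^4^4) set"
  where "V = {A. transpose A = A \<and> trace A = 0}"

text \<open>For \<open>g\<close> in \<open>SO(4)\<close> the transpose is the inverse, so this is simultaneous conjugation.\<close>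

fun act4 :: "real^4^4 \<Rightarrow> (real^4^4) \<times> (real^4^4) \<Rightarrow> (real^4^4) \<times> (real^4^4)"
  where "act4 g (A, B) = (g ** A ** transpose g, g ** B ** transpose g)"

fun \<mu> :: "(real^4^4) \<times> (real^4^4) \<Rightarrow> real^4^4"
  where "\<mu> (A, B) = A ** B - B ** A"

definition \<mu>_zero :: "((real^4^4) \<times> (real^4^4)) set"
  where "\<mu>_zero = {x \<in> V \<times> V. \<mu> x = 0}"


section \<open>The isomorphism \<open>\<Phi>\<close>\<close>

text \<open>The vector \<open>(x\<^sub>1, x\<^sub>2, x\<^sub>3, x\<^sub>4)\<close> stands for the quaternion
  \<open>x\<^sub>1 + x\<^sub>2 \<i> + x\<^sub>3 \<j> + x\<^sub>4 \<k>\<close>.\<close>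

definition qmult :: "real^4 \<Rightarrow> real^4 \<Rightarrow> real^4"
  where "qmult x y = vector
    [x$1 * y$1 - x$2 * y$2 - x$3 * y$3 - x$4 * y$4,
     x$1 * y$2 + x$2 * y$1 + x$3 * y$4 - x$4 * y$3,
     x$1 * y$3 - x$2 * y$4 + x$3 * y$1 + x$4 * y$2,
     x$1 * y$4 + x$2 * y$3 - x$3 * y$2 + x$4 * y$1]"

definition imag_unit :: "3 \<Rightarrow> real^4"
  where "imag_unit i = (if i = 1 then axis 2 1 else if i = 2 then axis 3 1 else axis 4 1)"

definition L :: "3 \<Rightarrow> real^4^4"
  where "L i = matrix (\<lambda>v. qmult (imag_unit i) v)"

definition R :: "3 \<Rightarrow> real^4^4"
  where "R j = matrix (\<lambda>v. qmult v (imag_unit j))"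

definition \<Phi> :: "real^3^3 \<Rightarrow> real^4^4"
  where "\<Phi> X = (\<Sum>i\<in>UNIV. \<Sum>j\<in>UNIV. X$i$j *\<^sub>R (L i ** R j))"


section \<open>The action of \<open>S\<^sub>3\<close> on two copies of \<open>\<real>\<^sup>3\<close>\<close>

abbreviation S3 :: "(3 \<Rightarrow> 3) monoid"
  where "S3 \<equiv> BijGroup UNIV"

fun perm_act :: "(3 \<Rightarrow> 3) \<Rightarrow> (real^3) \<times> (real^3) \<Rightarrow> (real^3) \<times> (real^3)"
  where "perm_act \<sigma> (x, y) =
    ((\<chi> i. x $ (Hilbert_Choice.inv \<sigma> i)), (\<chi> i. y $ (Hilbert_Choice.inv \<sigma> i)))"

end

theory Submission
  imports Defs "HOL-Combinatorics.Permutations" "HOL-Computational_Algebra.Fundamental_Theorem_Algebra"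
begin

text \<open>Read a pair \<open>(A, B)\<close> of commuting symmetric matrices as the complex matrix \<open>A + \<i> B\<close>. The
  two matrices are diagonal in a common orthonormal basis, and permutation matrices with suitable
  signs are rotations, so the orbit of the pair under rotations is the unordered family of its
  complex joint eigenvalues, that is, the set of roots with multiplicity of a monic complex
  polynomial (\<open>joint_eigenvalues_eq_imp_conjugate\<close>).

  Thus \<open>\<mu>\<^sup>-\<^sup>1(0)/SO(4)\<close> is the space of monic quartics with roots of sum zero, while
  \<open>(\<real>\<^sup>3 \<oplus> \<real>\<^sup>3)/S\<^sub>3 = \<complex>\<^sup>3/S\<^sub>3\<close> is the space of monic cubics. By the fundamental theorem of algebra the
  coefficients are free, so both spaces are \<open>\<complex>\<^sup>3\<close>. Coefficients bound roots; hence the coefficient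
  maps are closed, and the bijections are homeomorphisms (\<open>orbit_space_homeomorphic_euclidean\<close>).
  The two sides are quotients of \<open>\<complex>\<^sup>3\<close> by different groups, \<open>S\<^sub>4\<close> permuting four joint eigenvalues
  of sum zero and \<open>S\<^sub>3\<close> permuting three coordinates; only the polynomial coefficients relate them.

  For the injection put \<open>Z = Q + \<i> P\<close>. The power traces of \<open>\<Phi>(Z)\<close> are polynomials in
  \<open>tr W\<close>, \<open>tr W\<^sup>2\<close> and \<open>det Z\<close>, where \<open>W = Z\<^sup>T Z\<close>, and conversely (\<open>power_traces_\<Phi>_eq_iff\<close>). These three
  numbers are invariant under \<open>Z \<mapsto> g Z h\<^sup>T\<close>, so the map of orbits is well defined. They also
  separate the orbits (\<open>bi_rotation_invariants_eq_imp_rotate\<close>): the symmetry conditions make the real and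
  imaginary parts of \<open>W\<close> commute, so equal invariants give a rotation \<open>h\<close> that conjugates \<open>W\<close> to \<open>W'\<close>.
  Since \<open>Z\<^sup>* Z\<close> is real and is the positive square root of \<open>(Re W)\<^sup>2 + (Im W)\<^sup>2\<close>, the same \<open>h\<close>
  conjugates \<open>P\<^sup>T P\<close>, and \<open>g = P' h P\<^sup>-\<^sup>1\<close> completes the pair.\<close>

section \<open>Orbit spaces homeomorphic to a Euclidean space\<close>

text \<open>A quotient map determines its target up to homeomorphism by its fibres alone: each of the two
  maps descends along the other.\<close>

lemma homeomorphic_space_quotients_same_fibres:
  assumes p: "quotient_map X Y p" and q: "quotient_map X Z q"
    and fibres: "\<And>x y. \<lbrakk>x \<in> topspace X; y \<in> topspace X\<rbrakk> \<Longrightarrow> p x = p y \<longleftrightarrow> q x = q y"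
  shows "Y homeomorphic_space Z"
proof -
  have "\<exists>f. continuous_map Y Z f \<and> (\<forall>x\<in>topspace X. f (p x) = q x)"
  proof (rule quotient_map_lift_exists[OF p quotient_imp_continuous_map[OF q]])
    show "q x = q y" if "x \<in> topspace X" "y \<in> topspace X" "p x = p y" for x y
      using fibres[OF that(1,2)] that(3) by (rule iffD1)
  qed blast
  then obtain f where f: "continuous_map Y Z f" "\<And>x. x \<in> topspace X \<Longrightarrow> f (p x) = q x"
    by blast
  have "\<exists>g. continuous_map Z Y g \<and> (\<forall>x\<in>topspace X. g (q x) = p x)"
  proof (rule quotient_map_lift_exists[OF q quotient_imp_continuous_map[OF p]])
    show "p x = p y" if "x \<in> topspace X" "y \<in> topspace X" "q x = q y" for x y
      using fibres[OF that(1,2)] that(3) by (rule iffD2)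
  qed blast
  then obtain g where g: "continuous_map Z Y g" "\<And>x. x \<in> topspace X \<Longrightarrow> g (q x) = p x"
    by blast
  have "g (f y) = y" if "y \<in> topspace Y" for y
  proof -
    from that obtain x where "x \<in> topspace X" "y = p x"
      using quotient_imp_surjective_map[OF p] by blast
    then show ?thesis using f(2) g(2) by simp
  qed
  moreover have "f (g z) = z" if "z \<in> topspace Z" for z
  proof -
    from that obtain x where "x \<in> topspace X" "z = q x"
      using quotient_imp_surjective_map[OF q] by blast
    then show ?thesis using f(2) g(2) by simp
  qed
  ultimately have "homeomorphic_maps Y Z f g"
    unfolding homeomorphic_maps_def using f(1) g(1) by blast
  then show ?thesis
    unfolding homeomorphic_space_def by blast
qed

text \<open>Bounded preimages of bounded sets make \<open>F\<close> a closed map, by extraction of a convergent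
  subsequence; a closed continuous surjection is a quotient map, and the orbit map is another one
  with the same fibres.\<close>

lemma orbit_space_homeomorphic_euclidean:
  fixes F :: "'x::euclidean_space \<Rightarrow> 'y::euclidean_space"
  assumes "closed E" and cont: "continuous_on E F" and surj: "F ` E = UNIV"
    and fibres: "\<And>x y. \<lbrakk>x \<in> E; y \<in> E\<rbrakk> \<Longrightarrow> orbit G \<phi> x = orbit G \<phi> y \<longleftrightarrow> F x = F y"
    and bdd: "\<And>c. bounded {x \<in> E. norm (F x) \<le> c}"
  shows "orbit_space G E \<phi> homeomorphic_space (euclidean :: 'y topology)"
proof (rule homeomorphic_space_quotients_same_fibres)
  show "quotient_map (top_of_set E) (orbit_space G E \<phi>) (orbit G \<phi>)"
    by (rule quotient_map_orbit_space)
  have "closed (F ` C)" if "closed C" "C \<subseteq> E" for C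
    unfolding closed_sequential_limits
  proof (intro allI impI, elim conjE)
    fix y l assume y: "\<forall>n. y n \<in> F ` C" and l: "y \<longlonglongrightarrow> l"
    from y have "\<forall>n. \<exists>v. v \<in> C \<and> F v = y n"
      by (simp add: image_iff) metis
    then obtain x where x: "\<And>n. x n \<in> C" "\<And>n. F (x n) = y n"
      using choice[of "\<lambda>n v. v \<in> C \<and> F v = y n"] by blast
    obtain c where "\<And>n. norm (y n) \<le> c"
      using convergent_imp_bounded[OF l] unfolding bounded_iff by blast
    then have "range x \<subseteq> {x \<in> E. norm (F x) \<le> c}"
      using x \<open>C \<subseteq> E\<close> by auto
    then have "bounded (range x)"
      by (rule bounded_subset[OF bdd])
    then obtain z r where zr: "strict_mono (r :: nat \<Rightarrow> nat)" "(x \<circ> r) \<longlonglongrightarrow> z"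
      using bounded_imp_convergent_subsequence[of x] by blast
    have z: "z \<in> C"
      by (rule closed_sequentially[OF \<open>closed C\<close> _ zr(2)]) (simp add: x(1))
    have "(\<lambda>n. F ((x \<circ> r) n)) \<longlonglongrightarrow> F z"
      using z \<open>C \<subseteq> E\<close> x(1)
      by (intro continuous_on_tendsto_compose[OF cont zr(2)] always_eventually) auto
    moreover have "(\<lambda>n. F ((x \<circ> r) n)) \<longlonglongrightarrow> l"
      using LIMSEQ_subseq_LIMSEQ[OF l zr(1)] x(2) by (simp add: o_def)
    ultimately have "F z = l"
      by (rule LIMSEQ_unique)
    then show "l \<in> F ` C"
      using z by blast
  qed
  then have "closed_map (top_of_set E) euclidean F"
    unfolding closed_map_def closedin_closed_eq[OF \<open>closed E\<close>] closed_closedin[symmetric] by blast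
  then show "quotient_map (top_of_set E) euclidean F"
    using cont surj by (intro continuous_closed_imp_quotient_map) simp_all
qed (simp add: fibres)

section \<open>Monic complex polynomials and their roots\<close>

lemma linear_factors_eq_imp_permuted:
  fixes z w :: "'n::finite \<Rightarrow> complex"
  assumes "(\<Prod>i\<in>UNIV. [:- z i, 1:]) = (\<Prod>i\<in>UNIV. [:- w i, 1:])"
  obtains \<sigma> where "bij \<sigma>" and "\<And>i. w i = z (\<sigma> i)"
proof -
  have "proots (\<Prod>i\<in>UNIV. [:- u i, 1:]) = image_mset u (mset_set UNIV)" for u :: "'n \<Rightarrow> complex"
    by (subst proots_prod) (auto simp: sum_unfold_sum_mset)
  with assms have "image_mset w (mset_set UNIV) = image_mset z (mset_set UNIV)"
    by metis
  then obtain \<sigma> where "\<sigma> permutes UNIV" "\<forall>i\<in>UNIV. w i = z (\<sigma> i)"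
    by (rule image_mset_eq_implies_permutes[OF finite])
  then show thesis
    using that permutes_bij by blast
qed

lemma monic_complex_poly_splits:
  fixes p :: "complex poly"
  assumes "lead_coeff p = 1" and "degree p = CARD('n::finite)"
  obtains z :: "'n::finite \<Rightarrow> complex" where "p = (\<Prod>i\<in>UNIV. [:- z i, 1:])"
proof -
  have "p \<noteq> 0" using assms(1) by auto
  then obtain M where M: "size M = degree p" "p = (\<Prod>x\<in>#M. [:- x, 1:])"
    using alg_closed_imp_factorization[of p] assms(1) by auto
  obtain xs where xs: "mset xs = M" using ex_mset by blast
  obtain h where h: "bij_betw h (UNIV :: 'n set) {..<length xs}"
    using finite_same_card_bij[of "UNIV :: 'n set" "{..<length xs}"] M(1) xs assms(2) by auto
  have "p = (\<Prod>k<length xs. [:- (xs ! k), 1:])"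
    unfolding M(2) xs[symmetric] mset_map[symmetric] prod_mset_prod_list prod.list_conv_set_nth
    by (simp add: atLeast0LessThan)
  also have "\<dots> = (\<Prod>i\<in>UNIV. [:- (xs ! h i), 1:])"
    by (rule prod.reindex_bij_betw[OF h, symmetric])
  finally show thesis by (rule that)
qed

lemma prod_UNIV_3: "(\<Prod>i\<in>(UNIV :: 3 set). f i) = f 1 * f 2 * f 3"
  unfolding UNIV_3 by (simp add: mult.assoc)

lemma prod_UNIV_4: "(\<Prod>i\<in>(UNIV :: 4 set). f i) = f 1 * f 2 * f 3 * f 4"
  unfolding UNIV_4 by (simp add: mult.assoc)

lemma linear_factors_3:
  fixes z :: "3 \<Rightarrow> complex"
  shows "(\<Prod>i\<in>UNIV. [:- z i, 1:]) =
    [:- (z 1 * z 2 * z 3), z 1 * z 2 + z 1 * z 3 + z 2 * z 3, - (z 1 + z 2 + z 3), 1:]"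
  by (simp add: prod_UNIV_3 algebra_simps)

lemma linear_factors_4_coeffs:
  fixes z :: "4 \<Rightarrow> complex"
  shows "(\<Prod>i\<in>UNIV. [:- z i, 1:]) =
    [:z 1 * z 2 * z 3 * z 4,
      - (z 1 * z 2 * z 3 + z 1 * z 2 * z 4 + z 1 * z 3 * z 4 + z 2 * z 3 * z 4),
      z 1 * z 2 + z 1 * z 3 + z 1 * z 4 + z 2 * z 3 + z 2 * z 4 + z 3 * z 4,
      - (z 1 + z 2 + z 3 + z 4), 1:]"
  by (simp add: prod_UNIV_4 algebra_simps)

text \<open>Newton's identities for four numbers of sum zero: the elementary symmetric functions are
  polynomials in the power sums of order 2, 3 and 4.\<close>

lemma linear_factors_4:
  fixes z :: "4 \<Rightarrow> complex"
  assumes "(\<Sum>i\<in>UNIV. z i) = 0"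
  shows "(\<Prod>i\<in>UNIV. [:- z i, 1:]) =
    [:(\<Sum>i\<in>UNIV. z i ^ 2)\<^sup>2 / 8 - (\<Sum>i\<in>UNIV. z i ^ 4) / 4, - (\<Sum>i\<in>UNIV. z i ^ 3) / 3,
      - (\<Sum>i\<in>UNIV. z i ^ 2) / 2, 0, 1:]"
proof -
  have newton:
    "a * b * c * d = (a\<^sup>2 + b\<^sup>2 + c\<^sup>2 + d\<^sup>2)\<^sup>2 / 8 - (a ^ 4 + b ^ 4 + c ^ 4 + d ^ 4) / 4"
    "- (a * b * c + a * b * d + a * c * d + b * c * d) = - (a ^ 3 + b ^ 3 + c ^ 3 + d ^ 3) / 3"
    "a * b + a * c + a * d + b * c + b * d + c * d = - (a\<^sup>2 + b\<^sup>2 + c\<^sup>2 + d\<^sup>2) / 2"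
    if "a + b + c + d = 0" for a b c d :: complex
  proof -
    have d: "d = - (a + b + c)"
      using that by (simp add: add_eq_0_iff)
    have "8 * (a * b * c * d) = (a\<^sup>2 + b\<^sup>2 + c\<^sup>2 + d\<^sup>2)\<^sup>2 - 2 * (a ^ 4 + b ^ 4 + c ^ 4 + d ^ 4)"
      unfolding d by (simp add: algebra_simps power2_eq_square power4_eq_xxxx)
    then show "a * b * c * d = (a\<^sup>2 + b\<^sup>2 + c\<^sup>2 + d\<^sup>2)\<^sup>2 / 8 - (a ^ 4 + b ^ 4 + c ^ 4 + d ^ 4) / 4"
      by (simp add: field_simps)
    have "3 * (a * b * c + a * b * d + a * c * d + b * c * d) = a ^ 3 + b ^ 3 + c ^ 3 + d ^ 3"
      unfolding d by (simp add: algebra_simps power2_eq_square power3_eq_cube)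
    then show "- (a * b * c + a * b * d + a * c * d + b * c * d) = - (a ^ 3 + b ^ 3 + c ^ 3 + d ^ 3) / 3"
      by (simp add: field_simps)
    have "2 * (a * b + a * c + a * d + b * c + b * d + c * d) = - (a\<^sup>2 + b\<^sup>2 + c\<^sup>2 + d\<^sup>2)"
      unfolding d by (simp add: algebra_simps power2_eq_square power3_eq_cube)
    then show "a * b + a * c + a * d + b * c + b * d + c * d = - (a\<^sup>2 + b\<^sup>2 + c\<^sup>2 + d\<^sup>2) / 2"
      by (simp add: field_simps)
  qed
  have sum_zero: "z 1 + z 2 + z 3 + z 4 = 0"
    using assms by (simp add: sum_4)
  show ?thesis
    unfolding linear_factors_4_coeffs sum_4 newton[OF sum_zero] sum_zero by simp
qed

section \<open>Joint diagonalization of commuting symmetric matrices\<close>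

lemma symmetric_matrix_inner:
  fixes A :: "real^'n^'n"
  assumes "transpose A = A"
  shows "(A *v x) \<bullet> y = x \<bullet> (A *v y)"
  by (metis assms dot_lmul_matrix transpose_matrix_vector)

text \<open>A maximizer \<open>v\<close> of the Rayleigh quotient on \<open>S\<close> is an eigenvector: the form
  \<open>q x = c (x \<bullet> x) - x \<bullet> A x\<close> is nonnegative on \<open>S\<close> and vanishes at \<open>v\<close>, so its first variation
  at \<open>v\<close> in the direction of the residual \<open>r = c v - A v\<close>, which is a multiple of \<open>r \<bullet> r\<close>, is zero.\<close>

lemma eigenvector_in_invariant_subspace:
  fixes A :: "real^'n^'n"
  assumes sym: "transpose A = A" and S: "subspace S" and "y \<in> S" "y \<noteq> 0"
    and inv: "\<And>x. x \<in> S \<Longrightarrow> A *v x \<in> S"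
  obtains v c where "v \<in> S" "norm v = 1" "A *v v = c *\<^sub>R v"
proof -
  define K where "K = S \<inter> sphere 0 1"
  have "compact K"
    unfolding K_def by (intro closed_Int_compact closed_subspace S compact_sphere)
  moreover have "y /\<^sub>R norm y \<in> K"
    using assms by (simp add: K_def subspace_scale)
  moreover have "continuous_on K (\<lambda>x. x \<bullet> (A *v x))"
    by (intro continuous_intros linear_continuous_on_compose[OF _ matrix_vector_mul_linear])
  ultimately obtain v where v: "v \<in> K" and max: "\<And>x. x \<in> K \<Longrightarrow> x \<bullet> (A *v x) \<le> v \<bullet> (A *v v)"
    using continuous_attains_sup[of K "\<lambda>x. x \<bullet> (A *v x)"] by blast
  define c where "c = v \<bullet> (A *v v)"
  have vS: "v \<in> S" "norm v = 1"
    using v by (auto simp: K_def)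
  define q where "q x = c * (x \<bullet> x) - x \<bullet> (A *v x)" for x
  have q_nonneg: "q x \<ge> 0" if "x \<in> S" for x
  proof (cases "x = 0")
    case False
    then have "x /\<^sub>R norm x \<in> K"
      using that S by (simp add: K_def subspace_scale)
    from max[OF this] False show ?thesis
      by (simp add: q_def c_def matrix_vector_mult_scaleR field_simps dot_square_norm
          power2_eq_square)
  qed (simp add: q_def)
  define r where "r = c *\<^sub>R v - A *v v"
  have rS: "r \<in> S"
    using vS inv S by (simp add: r_def subspace_diff subspace_scale)
  have "q (v + t *\<^sub>R r) = 2 * t * (r \<bullet> r) + t\<^sup>2 * q r" for t
  proof -
    have "q (v + t *\<^sub>R r) = q v + 2 * t * (c * (v \<bullet> r) - (A *v v) \<bullet> r) + t\<^sup>2 * q r"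
      by (simp add: q_def matrix_vector_mult_scaleR matrix_vector_right_distrib inner_add_left
          inner_add_right symmetric_matrix_inner[OF sym] inner_commute[of r "A *v v"]
          inner_commute[of r v] power2_eq_square algebra_simps)
    moreover have "q v = 0"
      using vS by (simp add: q_def c_def dot_square_norm)
    moreover have "c * (v \<bullet> r) - (A *v v) \<bullet> r = r \<bullet> r"
      by (simp add: r_def inner_diff_left)
    ultimately show ?thesis by simp
  qed
  then have quad: "2 * t * (r \<bullet> r) + t\<^sup>2 * q r \<ge> 0" for t
    using q_nonneg[of "v + t *\<^sub>R r"] vS rS S by (simp add: subspace_add subspace_scale)
  have "r \<bullet> r = 0"
  proof (rule ccontr)
    assume "r \<bullet> r \<noteq> 0"
    then have pos: "r \<bullet> r > 0" by simp
    have d: "q r + 1 > 0" using q_nonneg[OF rS] by simp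
    \<comment> \<open>Minimizing the quadratic in \<open>t\<close>, with \<open>q r + 1\<close> in place of \<open>q r\<close> to keep the denominator
        positive, makes it negative.\<close>
    define t where "t = - (r \<bullet> r) / (q r + 1)"
    have t: "t * (q r + 1) = - (r \<bullet> r)" "t < 0"
      using d pos by (auto simp: t_def field_simps)
    have "2 * t * (r \<bullet> r) + t\<^sup>2 * q r = t * (r \<bullet> r) - t\<^sup>2"
      using t(1) by algebra
    moreover have "t * (r \<bullet> r) < 0" using t(2) pos by (simp add: mult_neg_pos)
    ultimately show False using quad[of t] by (smt (verit) zero_le_power2)
  qed
  then have "A *v v = c *\<^sub>R v" by (simp add: r_def)
  with vS show thesis by (rule that)
qed

text \<open>An eigenspace of \<open>A\<close> in \<open>S\<close> is invariant under every matrix that commutes with \<open>A\<close>.\<close>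

lemma common_eigenvector_in_invariant_subspace:
  fixes A B :: "real^'n^'n"
  assumes sym: "transpose A = A" "transpose B = B" and comm: "A ** B = B ** A"
    and S: "subspace S" and y: "y \<in> S" "y \<noteq> 0"
    and inv: "\<And>x. x \<in> S \<Longrightarrow> A *v x \<in> S" "\<And>x. x \<in> S \<Longrightarrow> B *v x \<in> S"
  obtains v c d where "v \<in> S" "norm v = 1" "A *v v = c *\<^sub>R v" "B *v v = d *\<^sub>R v"
proof -
  obtain u c where u: "u \<in> S" "norm u = 1" "A *v u = c *\<^sub>R u"
    using eigenvector_in_invariant_subspace[OF sym(1) S y inv(1)] by blast
  define T where "T = {x \<in> S. A *v x = c *\<^sub>R x}"
  have T: "subspace T"
    using S by (auto simp: T_def subspace_def matrix_vector_right_distrib matrix_vector_mult_scaleR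
        scaleR_add_right)
  have "u \<in> T" "u \<noteq> 0" using u by (auto simp: T_def)
  moreover have "B *v x \<in> T" if "x \<in> T" for x
  proof -
    have "A *v (B *v x) = B *v (A *v x)"
      by (simp add: matrix_vector_mul_assoc comm)
    then show ?thesis
      using that inv(2) by (simp add: T_def matrix_vector_mult_scaleR)
  qed
  ultimately obtain v d where "v \<in> T" "norm v = 1" "B *v v = d *\<^sub>R v"
    using eigenvector_in_invariant_subspace[OF sym(2) T] by blast
  then show thesis using that by (auto simp: T_def)
qed

text \<open>An orthonormal set of common eigenvectors of greatest size is a basis: its orthogonal complement
  is invariant under both matrices, so a nonzero complement would contain one more common
  eigenvector.\<close>

lemma orthonormal_common_eigenbasis:
  fixes A B :: "real^'n^'n"
  assumes sym: "transpose A = A" "transpose B = B" and comm: "A ** B = B ** A"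
  obtains E where "finite E" "card E = CARD('n)" "pairwise orthogonal E" "\<And>e. e \<in> E \<Longrightarrow> norm e = 1"
    "\<And>e. e \<in> E \<Longrightarrow> \<exists>c. A *v e = c *\<^sub>R e" "\<And>e. e \<in> E \<Longrightarrow> \<exists>d. B *v e = d *\<^sub>R e"
proof -
  define good where "good E \<longleftrightarrow> pairwise orthogonal E \<and>
    (\<forall>e\<in>E. norm e = 1 \<and> (\<exists>c. A *v e = c *\<^sub>R e) \<and> (\<exists>d. B *v e = d *\<^sub>R e))" for E
  have indep: "independent E" if "good E" for E
    using that by (intro pairwise_orthogonal_independent) (auto simp: good_def)
  have fin: "finite E" and le: "card E \<le> CARD('n)" if "good E" for E
    using independent_bound[OF indep[OF that]] by auto
  have "good {}" by (simp add: good_def)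
  then obtain E where E: "good E" and max: "\<And>F. good F \<Longrightarrow> card F \<le> card E"
    using ex_has_greatest_nat[of good "{}" card "Suc CARD('n)"] le by (metis less_Suc_eq_le)
  have "card E = CARD('n)"
  proof (rule ccontr)
    assume "card E \<noteq> CARD('n)"
    then have "card E < DIM(real^'n)" using le[OF E] by simp
    then have "dim E < DIM(real^'n)" using dim_le_card'[OF fin[OF E]] by linarith
    then obtain y where y: "y \<noteq> 0" "\<And>e. e \<in> span E \<Longrightarrow> orthogonal y e"
      using orthogonal_to_subspace_exists[of E] by blast
    define S where "S = {x. \<forall>e\<in>E. e \<bullet> x = 0}"
    have S: "subspace S" by (auto simp: S_def subspace_def inner_add_right)
    have "y \<in> S" using y(2) by (auto simp: S_def orthogonal_def inner_commute span_base)
    have inv: "M *v x \<in> S" if "transpose M = M" "\<And>e. e \<in> E \<Longrightarrow> \<exists>c. M *v e = c *\<^sub>R e" "x \<in> S" for M x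
      unfolding S_def
    proof (intro CollectI ballI)
      fix e assume "e \<in> E"
      with that(2) obtain c where "M *v e = c *\<^sub>R e" by blast
      with \<open>e \<in> E\<close> \<open>x \<in> S\<close> show "e \<bullet> (M *v x) = 0"
        by (simp add: symmetric_matrix_inner[OF that(1), symmetric] S_def)
    qed
    have invA: "A *v x \<in> S" if "x \<in> S" for x
      by (rule inv[OF sym(1) _ that]) (use E in \<open>auto simp: good_def\<close>)
    have invB: "B *v x \<in> S" if "x \<in> S" for x
      by (rule inv[OF sym(2) _ that]) (use E in \<open>auto simp: good_def\<close>)
    obtain v c d where v: "v \<in> S" "norm v = 1" "A *v v = c *\<^sub>R v" "B *v v = d *\<^sub>R v"
      using common_eigenvector_in_invariant_subspace[OF sym comm S \<open>y \<in> S\<close> y(1) invA invB] by blast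
    have "v \<notin> E" using v(1,2) by (force simp: S_def dot_square_norm)
    moreover have "good (insert v E)"
      using E v by (auto simp: good_def pairwise_insert S_def orthogonal_def inner_commute)
    ultimately show False using max[of "insert v E"] fin[OF E] by simp
  qed
  with E fin[OF E] show thesis by (intro that[of E]) (auto simp: good_def)
qed

definition diag :: "('n \<Rightarrow> 'a::zero) \<Rightarrow> 'a^'n^'n"
  where "diag d = (\<chi> i j. if i = j then d i else 0)"

lemma diag_nth [simp]: "diag d $ i $ j = (if i = j then d i else 0)"
  by (simp add: diag_def)

lemma matrix_mult_diag_nth:
  fixes X :: "'a::comm_semiring_1^'n::finite^'m"
  shows "(X ** diag d) $ i $ j = X $ i $ j * d j"
  by (simp add: matrix_matrix_mult_def if_distrib[of "\<lambda>y. _ * y"] cong: if_cong)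

lemma commuting_symmetric_diagonalization:
  fixes A B :: "real^'n^'n"
  assumes sym: "transpose A = A" "transpose B = B" and comm: "A ** B = B ** A"
  obtains U c d where "orthogonal_matrix U"
    "A = U ** diag c ** transpose U" "B = U ** diag d ** transpose U"
proof -
  obtain E where E: "finite E" "card E = CARD('n)" "pairwise orthogonal E"
    "\<And>e. e \<in> E \<Longrightarrow> norm e = 1"
    "\<And>e. e \<in> E \<Longrightarrow> \<exists>c. A *v e = c *\<^sub>R e" "\<And>e. e \<in> E \<Longrightarrow> \<exists>d. B *v e = d *\<^sub>R e"
    using orthonormal_common_eigenbasis[OF assms] by blast
  obtain u where u: "bij_betw u (UNIV :: 'n set) E"
    using finite_same_card_bij[of "UNIV :: 'n set" E] E(1,2) by auto
  then have uE: "u j \<in> E" for j by (auto simp: bij_betw_def)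
  define U where "U = (\<chi> i j. u j $ i)"
  have col: "column j U = u j" for j by (simp add: U_def column_def vec_eq_iff)
  have U: "orthogonal_matrix U"
    unfolding orthogonal_matrix_orthonormal_columns col
  proof (intro conjI allI impI)
    fix i j :: 'n assume "i \<noteq> j"
    then have "u i \<noteq> u j" using u by (auto simp: bij_betw_def inj_on_def)
    then show "orthogonal (u i) (u j)" using E(3) uE by (auto simp: pairwise_def)
  qed (simp add: E(4) uE)
  have diagonal: "\<exists>c. M = U ** diag c ** transpose U"
    if "\<And>e. e \<in> E \<Longrightarrow> \<exists>c. M *v e = c *\<^sub>R e" for M
  proof -
    from that uE have "\<forall>j. \<exists>c. M *v u j = c *\<^sub>R u j" by blast
    then obtain c where c: "\<And>j. M *v u j = c j *\<^sub>R u j" by metis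
    have "(M ** U) $ i $ j = (U ** diag c) $ i $ j" for i j
      using arg_cong[OF c[of j], of "\<lambda>x. x $ i"]
      unfolding matrix_mult_diag_nth
      by (simp add: matrix_matrix_mult_def matrix_vector_mult_def U_def)
    then have "M ** U = U ** diag c" by (simp add: vec_eq_iff)
    then have "M = U ** diag c ** transpose U"
      using U by (metis matrix_mul_assoc matrix_mul_rid orthogonal_matrix_def)
    then show ?thesis by blast
  qed
  obtain c where "A = U ** diag c ** transpose U" using diagonal E(5) by blast
  moreover obtain d where "B = U ** diag d ** transpose U" using diagonal E(6) by blast
  ultimately show thesis using that U by blast
qed

section \<open>Pairs of real matrices as complex matrices\<close>

primrec mpow :: "'a::comm_semiring_1^'n^'n \<Rightarrow> nat \<Rightarrow> 'a^'n^'n" where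
  "mpow M 0 = mat 1"
| "mpow M (Suc k) = M ** mpow M k"

lemma conjugate_mult:
  fixes M N :: "'a::comm_semiring_1^'n^'n"
  assumes "H ** G = mat 1"
  shows "(G ** M ** H) ** (G ** N ** H) = G ** (M ** N) ** H"
proof -
  have "(G ** M ** H) ** (G ** N ** H) = G ** M ** (H ** G) ** N ** H"
    by (simp only: matrix_mul_assoc)
  then show ?thesis
    by (simp only: assms matrix_mul_rid matrix_mul_assoc)
qed

lemma mpow_conjugate:
  fixes M :: "'a::comm_semiring_1^'n^'n"
  assumes "G ** H = mat 1" "H ** G = mat 1"
  shows "mpow (G ** M ** H) k = G ** mpow M k ** H"
  by (induction k) (simp_all only: mpow.simps conjugate_mult assms matrix_mul_rid)

lemma trace_conjugate:
  fixes M :: "'a::comm_semiring_1^'n^'n"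
  assumes "H ** G = mat 1"
  shows "trace (G ** M ** H) = trace M"
  by (simp add: assms trace_mul_sym[of "G ** M"] matrix_mul_assoc)

lemma transpose_diag [simp]: "transpose (diag d) = diag d"
  by (auto simp: transpose_def vec_eq_iff)

lemma diag_mult_diag:
  fixes c d :: "'n::finite \<Rightarrow> 'a::comm_semiring_1"
  shows "diag c ** diag d = diag (\<lambda>i. c i * d i)"
  by (simp add: vec_eq_iff matrix_mult_diag_nth)

lemma diag_one: "diag (\<lambda>i. 1) = mat 1"
  by (simp add: vec_eq_iff mat_def)

lemma mpow_diag:
  fixes d :: "'n::finite \<Rightarrow> 'a::comm_semiring_1"
  shows "mpow (diag d) k = diag (\<lambda>i. d i ^ k)"
  by (induction k) (simp_all add: diag_mult_diag diag_one)

lemma trace_diag: "trace (diag d) = (\<Sum>i\<in>UNIV. d i)"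
  by (simp add: trace_def)

lemma det_diag: "det (diag d) = (\<Prod>i\<in>UNIV. d i)"
  by (simp add: det_diagonal)

definition cmat :: "real^'n^'m \<Rightarrow> real^'n^'m \<Rightarrow> complex^'n^'m"
  where "cmat A B = (\<chi> i j. Complex (A $ i $ j) (B $ i $ j))"

lemma cmat_nth [simp]: "cmat A B $ i $ j = Complex (A $ i $ j) (B $ i $ j)"
  by (simp add: cmat_def)

lemma cmat_mult: "cmat A B ** cmat C D = cmat (A ** C - B ** D) (A ** D + B ** C)"
  by (simp add: vec_eq_iff matrix_matrix_mult_def complex_eq_iff sum_subtractf sum.distrib)

lemma transpose_cmat: "transpose (cmat A B) = cmat (transpose A) (transpose B)"
  by (simp add: vec_eq_iff transpose_def)

lemma transpose_cmat_real: "transpose (cmat A 0) = cmat (transpose A) 0"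
  by (simp add: vec_eq_iff transpose_def)

lemma cmat_one: "cmat (mat 1) 0 = mat 1"
  by (simp add: vec_eq_iff mat_def complex_eq_iff)

lemma matrix_mult_zero_left [simp]: "(0 :: 'a::semiring_1^'n^'m) ** A = 0"
  by (simp add: vec_eq_iff matrix_matrix_mult_def)

lemma matrix_mult_zero_right [simp]: "A ** (0 :: 'a::semiring_1^'n^'m) = 0"
  by (simp add: vec_eq_iff matrix_matrix_mult_def)

lemma cmat_diag: "cmat (diag c) (diag d) = diag (\<lambda>i. Complex (c i) (d i))"
  by (simp add: vec_eq_iff complex_eq_iff)

lemma cmat_real_mult:
  "cmat (G ** A ** H) (G ** B ** H) = cmat G 0 ** cmat A B ** cmat H 0"
  by (simp add: cmat_mult)

lemma cmat_orthogonal: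
  assumes "orthogonal_matrix G"
  shows "cmat G 0 ** cmat (transpose G) 0 = mat 1" "cmat (transpose G) 0 ** cmat G 0 = mat 1"
  using assms by (simp_all add: cmat_mult orthogonal_matrix_def cmat_one)

lemma power_trace_orthogonal_conjugate:
  assumes "orthogonal_matrix G"
  shows "trace (mpow (cmat (G ** A ** transpose G) (G ** B ** transpose G)) k)
    = trace (mpow (cmat A B) k)"
  unfolding cmat_real_mult
  by (simp add: mpow_conjugate trace_conjugate cmat_orthogonal[OF assms])

section \<open>Joint eigenvalues classify commuting symmetric pairs up to rotation\<close>

text \<open>Two real joint eigenvalues are packed into one complex number, so that the unordered family of
  pairs becomes the root multiset of one complex polynomial.\<close>

definition joint_eigenvalues :: "real^'n^'n \<Rightarrow> real^'n^'n \<Rightarrow> ('n \<Rightarrow> complex) \<Rightarrow> bool"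
  where "joint_eigenvalues A B z \<longleftrightarrow> (\<exists>U. orthogonal_matrix U \<and>
    A = U ** diag (\<lambda>i. Re (z i)) ** transpose U \<and> B = U ** diag (\<lambda>i. Im (z i)) ** transpose U)"

lemma joint_eigenvalues_exist:
  fixes A B :: "real^'n^'n"
  assumes "transpose A = A" "transpose B = B" "A ** B = B ** A"
  obtains z where "joint_eigenvalues A B z"
proof -
  obtain U c d where "orthogonal_matrix U"
    "A = U ** diag c ** transpose U" "B = U ** diag d ** transpose U"
    using commuting_symmetric_diagonalization[OF assms] by blast
  then have "joint_eigenvalues A B (\<lambda>i. Complex (c i) (d i))"
    unfolding joint_eigenvalues_def by auto
  then show thesis by (rule that)
qed

lemma joint_eigenvalues_cmat:
  assumes "joint_eigenvalues A B z"
  obtains U where "orthogonal_matrix U" "cmat A B = cmat U 0 ** diag z ** cmat (transpose U) 0"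
proof -
  obtain U where "orthogonal_matrix U" "A = U ** diag (\<lambda>i. Re (z i)) ** transpose U"
    "B = U ** diag (\<lambda>i. Im (z i)) ** transpose U"
    using assms unfolding joint_eigenvalues_def by blast
  then show thesis
    using that by (simp add: cmat_real_mult cmat_diag)
qed

lemma power_trace_joint_eigenvalues:
  assumes "joint_eigenvalues A B z"
  shows "trace (mpow (cmat A B) k) = (\<Sum>i\<in>UNIV. z i ^ k)"
proof -
  obtain U where U: "orthogonal_matrix U" "cmat A B = cmat U 0 ** diag z ** cmat (transpose U) 0"
    using joint_eigenvalues_cmat[OF assms] .
  show ?thesis
    unfolding U(2) mpow_conjugate[OF cmat_orthogonal[OF U(1)]]
    by (simp add: trace_conjugate cmat_orthogonal[OF U(1)] mpow_diag trace_diag)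
qed

lemma det_joint_eigenvalues:
  assumes "joint_eigenvalues A B z"
  shows "det (cmat A B) = (\<Prod>i\<in>UNIV. z i)"
proof -
  obtain U where U: "orthogonal_matrix U" "cmat A B = cmat U 0 ** diag z ** cmat (transpose U) 0"
    using joint_eigenvalues_cmat[OF assms] .
  have "det (cmat U 0) * det (cmat (transpose U) 0) = 1"
    by (metis U(1) cmat_orthogonal(1) det_I det_mul)
  then show ?thesis
    by (simp add: U(2) det_mul det_diag mult.commute mult.left_commute)
qed

lemma joint_eigenvalues_diag:
  "joint_eigenvalues (diag (\<lambda>i. Re (z i))) (diag (\<lambda>i. Im (z i))) z"
  unfolding joint_eigenvalues_def
  by (rule exI[of _ "mat 1"]) (simp add: orthogonal_matrix_id)

definition perm_matrix :: "('n \<Rightarrow> 'n) \<Rightarrow> real^'n^'n"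
  where "perm_matrix \<sigma> = (\<chi> i j. if j = \<sigma> i then 1 else 0)"

lemma perm_matrix_mult_nth: "(perm_matrix \<sigma> ** X) $ i $ j = X $ \<sigma> i $ j"
  by (simp add: perm_matrix_def matrix_matrix_mult_def if_distrib[of "\<lambda>y. y * _"] cong: if_cong)

lemma mult_transpose_perm_matrix_nth: "(X ** transpose (perm_matrix \<sigma>)) $ i $ j = X $ i $ \<sigma> j"
  by (simp add: perm_matrix_def matrix_matrix_mult_def transpose_def if_distrib[of "\<lambda>y. _ * y"]
      cong: if_cong)

lemma perm_matrix_diag:
  assumes "inj \<sigma>"
  shows "perm_matrix \<sigma> ** diag d ** transpose (perm_matrix \<sigma>) = diag (\<lambda>i. d (\<sigma> i))"
  by (simp add: vec_eq_iff mult_transpose_perm_matrix_nth perm_matrix_mult_nth inj_eq[OF assms])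

lemma orthogonal_perm_matrix:
  assumes "inj \<sigma>"
  shows "orthogonal_matrix (perm_matrix \<sigma>)"
proof -
  have "perm_matrix \<sigma> ** transpose (perm_matrix \<sigma>) = mat 1"
    using perm_matrix_diag[OF assms, of "\<lambda>_. 1"] by (simp add: diag_one)
  then show ?thesis
    by (simp add: orthogonal_matrix_def matrix_left_right_inverse)
qed

lemma orthogonal_diag_sign:
  assumes "\<And>i. s i * s i = (1::real)"
  shows "orthogonal_matrix (diag s)"
  using assms by (simp add: orthogonal_matrix_def diag_mult_diag diag_one)

text \<open>Equal root polynomials match the two families by a permutation, and the permutation matrix
  conjugates one diagonal form to the other. Diagonal sign matrices commute with the diagonal form,
  so the sign of the determinant of the conjugating matrix can be corrected.\<close>

lemma joint_eigenvalues_eq_imp_conjugate: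
  fixes A B A' B' :: "real^'n^'n"
  assumes "joint_eigenvalues A B z" "joint_eigenvalues A' B' w"
    and "(\<Prod>i\<in>UNIV. [:- z i, 1:]) = (\<Prod>i\<in>UNIV. [:- w i, 1:])"
  obtains g where "rotation_matrix g" "A' = g ** A ** transpose g" "B' = g ** B ** transpose g"
proof -
  obtain \<sigma> where \<sigma>: "bij \<sigma>" "\<And>i. w i = z (\<sigma> i)"
    using linear_factors_eq_imp_permuted[OF assms(3)] by blast
  define P where "P = perm_matrix \<sigma>"
  have P: "orthogonal_matrix P" "P ** diag (\<lambda>i. f (z i)) ** transpose P = diag (\<lambda>i. f (w i))" for f
    using \<sigma> by (simp_all add: P_def orthogonal_perm_matrix perm_matrix_diag bij_is_inj)
  obtain U where U: "orthogonal_matrix U" "A = U ** diag (\<lambda>i. Re (z i)) ** transpose U"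
    "B = U ** diag (\<lambda>i. Im (z i)) ** transpose U"
    using assms(1) unfolding joint_eigenvalues_def by blast
  obtain W where W: "orthogonal_matrix W" "A' = W ** diag (\<lambda>i. Re (w i)) ** transpose W"
    "B' = W ** diag (\<lambda>i. Im (w i)) ** transpose W"
    using assms(2) unfolding joint_eigenvalues_def by blast
  define g where "g s = W ** diag s ** P ** transpose U" for s
  have conj: "g s ** (U ** diag (\<lambda>i. f (z i)) ** transpose U) ** transpose (g s)
      = W ** diag (\<lambda>i. f (w i)) ** transpose W"
    if s: "\<And>i. s i * s i = 1" for s f
  proof -
    have signs: "s i * f (w i) * s i = f (w i)" for i
      using s[of i] by algebra
    have "g s ** (U ** diag (\<lambda>i. f (z i)) ** transpose U) ** transpose (g s)
       = W ** diag s ** P ** (transpose U ** U) ** diag (\<lambda>i. f (z i)) ** (transpose U ** U)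
          ** transpose P ** diag s ** transpose W"
      by (simp only: g_def matrix_transpose_mul transpose_transpose transpose_diag matrix_mul_assoc)
    also have "\<dots> = W ** diag s ** (P ** diag (\<lambda>i. f (z i)) ** transpose P) ** diag s ** transpose W"
      using U(1) by (simp add: orthogonal_matrix_def matrix_mul_assoc)
    also have "\<dots> = W ** (diag s ** diag (\<lambda>i. f (w i)) ** diag s) ** transpose W"
      by (simp only: P matrix_mul_assoc)
    also have "diag s ** diag (\<lambda>i. f (w i)) ** diag s = diag (\<lambda>i. f (w i))"
      by (simp only: diag_mult_diag signs)
    finally show ?thesis .
  qed
  have orth: "orthogonal_matrix (g s)" if "\<And>i. s i * s i = 1" for s
    using that P(1) U(1) W(1) unfolding g_def
    by (intro orthogonal_matrix_mul) (simp_all add: orthogonal_diag_sign)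
  have "\<exists>s. (\<forall>i. s i * s i = 1) \<and> det (g s) = 1"
  proof (cases "det (g (\<lambda>_. 1)) = 1")
    case False
    then have minus: "det (g (\<lambda>_. 1)) = -1"
      using det_orthogonal_matrix[OF orth[of "\<lambda>_. 1"]] by auto
    obtain k :: 'n where True by blast
    define s :: "'n \<Rightarrow> real" where "s i = (if i = k then -1 else 1)" for i
    have "det (diag s) = -1" by (simp add: det_diag s_def)
    then have "det (g s) = 1"
      using minus by (simp add: g_def det_mul diag_one)
    moreover have "\<forall>i. s i * s i = 1" by (simp add: s_def)
    ultimately show ?thesis by blast
  qed (auto intro: exI[of _ "\<lambda>_. 1"])
  then obtain s where s: "\<And>i. s i * s i = 1" "det (g s) = 1" by blast
  show thesis
  proof
    show "rotation_matrix (g s)" using orth s by (simp add: rotation_matrix_def)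
    show "A' = g s ** A ** transpose (g s)"
      unfolding U(2) W(2) by (rule conj[OF s(1), symmetric])
    show "B' = g s ** B ** transpose (g s)"
      unfolding U(3) W(3) by (rule conj[OF s(1), symmetric])
  qed
qed

section \<open>Equality of orbits\<close>

lemma orbit_eq_iff:
  assumes "Group.group G"
    and one: "\<And>x. \<phi> \<one>\<^bsub>G\<^esub> x = x"
    and mult: "\<And>g h x. \<lbrakk>g \<in> carrier G; h \<in> carrier G\<rbrakk> \<Longrightarrow> \<phi> (g \<otimes>\<^bsub>G\<^esub> h) x = \<phi> g (\<phi> h x)"
  shows "orbit G \<phi> x = orbit G \<phi> y \<longleftrightarrow> (\<exists>g\<in>carrier G. y = \<phi> g x)"
proof -
  interpret Group.group G by fact
  have orbit_subset: "orbit G \<phi> (\<phi> g u) \<subseteq> orbit G \<phi> u" if "g \<in> carrier G" for g u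
  proof
    fix v assume "v \<in> orbit G \<phi> (\<phi> g u)"
    then obtain h where h: "h \<in> carrier G" "v = \<phi> h (\<phi> g u)"
      by (auto simp: orbit_def)
    then have "v = \<phi> (h \<otimes>\<^bsub>G\<^esub> g) u"
      using mult that by simp
    then show "v \<in> orbit G \<phi> u"
      using h(1) that unfolding orbit_def by blast
  qed
  show ?thesis
  proof
    assume "orbit G \<phi> x = orbit G \<phi> y"
    moreover have "\<phi> \<one>\<^bsub>G\<^esub> y \<in> orbit G \<phi> y"
      unfolding orbit_def using one_closed by blast
    then have "y \<in> orbit G \<phi> y"
      by (simp only: one)
    ultimately show "\<exists>g\<in>carrier G. y = \<phi> g x"
      by (auto simp: orbit_def)
  next
    assume "\<exists>g\<in>carrier G. y = \<phi> g x"
    then obtain g where g: "g \<in> carrier G" "y = \<phi> g x" by blast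
    then have "\<phi> (inv\<^bsub>G\<^esub> g) y = x"
      using mult[of "inv\<^bsub>G\<^esub> g" g x] one by simp
    then show "orbit G \<phi> x = orbit G \<phi> y"
      using orbit_subset[of g x] orbit_subset[of "inv\<^bsub>G\<^esub> g" y] g by auto
  qed
qed

lemma rotation_matrix_mult:
  fixes A B :: "real^'n^'n"
  shows "rotation_matrix A \<Longrightarrow> rotation_matrix B \<Longrightarrow> rotation_matrix (A ** B)"
  by (simp add: rotation_matrix_def orthogonal_matrix_mul det_mul)

lemma rotation_matrix_transpose:
  fixes A :: "real^'n^'n"
  shows "rotation_matrix A \<Longrightarrow> rotation_matrix (transpose A)"
  by (simp add: rotation_matrix_def)

lemma group_SO: "Group.group (SO :: (real^'n^'n) monoid)"
proof (rule groupI)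
  show "\<exists>y\<in>carrier SO. y \<otimes>\<^bsub>SO\<^esub> x = \<one>\<^bsub>SO\<^esub>" if "x \<in> carrier SO" for x :: "real^'n^'n"
    using that by (intro bexI[of _ "transpose x"])
      (auto simp: SO_def rotation_matrix_transpose rotation_matrix_def orthogonal_matrix_def)
qed (auto simp: SO_def rotation_matrix_mult matrix_mul_assoc rotation_matrix_def[of "mat 1"]
    orthogonal_matrix_id)

lemma orbit_act4_eq_iff:
  "orbit SO act4 (A, B) = orbit SO act4 (A', B') \<longleftrightarrow>
    (\<exists>g. rotation_matrix g \<and> A' = g ** A ** transpose g \<and> B' = g ** B ** transpose g)"
proof -
  have "orbit SO act4 x = orbit SO act4 y \<longleftrightarrow> (\<exists>g\<in>carrier SO. y = act4 g x)" for x y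
  proof (rule orbit_eq_iff[OF group_SO])
    show "act4 \<one>\<^bsub>SO\<^esub> x = x" for x by (cases x) (simp add: SO_def)
    show "act4 (g \<otimes>\<^bsub>SO\<^esub> h) x = act4 g (act4 h x)" for g h x
      by (cases x) (simp add: SO_def matrix_transpose_mul matrix_mul_assoc)
  qed
  then show ?thesis by (auto simp: SO_def)
qed

lemma orbit_act33_eq_iff:
  "orbit (SO \<times>\<times> SO) act33 (Q, P) = orbit (SO \<times>\<times> SO) act33 (Q', P') \<longleftrightarrow>
    (\<exists>g h. rotation_matrix g \<and> rotation_matrix h \<and>
      Q' = g ** Q ** transpose h \<and> P' = g ** P ** transpose h)"
proof -
  have "orbit (SO \<times>\<times> SO) act33 x = orbit (SO \<times>\<times> SO) act33 y \<longleftrightarrow>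
      (\<exists>g\<in>carrier (SO \<times>\<times> SO). y = act33 g x)" for x y
  proof (rule orbit_eq_iff[OF DirProd_group[OF group_SO group_SO]])
    show "act33 \<one>\<^bsub>SO \<times>\<times> SO\<^esub> x = x" for x by (cases x) (simp add: SO_def)
    show "act33 (g \<otimes>\<^bsub>SO \<times>\<times> SO\<^esub> h) x = act33 g (act33 h x)" for g h x
      by (cases x; cases g; cases h) (simp add: SO_def matrix_transpose_mul matrix_mul_assoc)
  qed
  then show ?thesis by (auto simp: SO_def)
qed

lemma orbit_perm_act_eq_iff:
  "orbit S3 perm_act (x, y) = orbit S3 perm_act (x', y') \<longleftrightarrow>
    (\<exists>\<sigma>. bij \<sigma> \<and> (\<forall>i. x' $ i = x $ \<sigma> i) \<and> (\<forall>i. y' $ i = y $ \<sigma> i))"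
proof -
  have carrier: "carrier S3 = {\<sigma>. bij \<sigma>}"
    by (auto simp: BijGroup_def Bij_def extensional_def)
  have "orbit S3 perm_act u = orbit S3 perm_act v \<longleftrightarrow> (\<exists>\<sigma>\<in>carrier S3. v = perm_act \<sigma> u)" for u v
  proof (rule orbit_eq_iff[OF group_BijGroup])
    show "perm_act \<one>\<^bsub>S3\<^esub> u = u" for u
      by (cases u) (simp add: BijGroup_def restrict_def inv_id[unfolded id_def])
    show "perm_act (\<sigma> \<otimes>\<^bsub>S3\<^esub> \<tau>) u = perm_act \<sigma> (perm_act \<tau> u)"
      if "\<sigma> \<in> carrier S3" "\<tau> \<in> carrier S3" for \<sigma> \<tau> u
    proof -
      have "\<sigma> \<otimes>\<^bsub>S3\<^esub> \<tau> = \<sigma> \<circ> \<tau>"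
        using that by (auto simp: BijGroup_def compose_def)
      then show ?thesis
        using that by (cases u) (simp add: carrier o_inv_distrib)
    qed
  qed
  moreover have "(\<exists>\<sigma>\<in>carrier S3. (x', y') = perm_act \<sigma> (x, y)) \<longleftrightarrow>
    (\<exists>\<sigma>. bij \<sigma> \<and> (\<forall>i. x' $ i = x $ \<sigma> i) \<and> (\<forall>i. y' $ i = y $ \<sigma> i))"
  proof safe
    fix \<sigma> :: "3 \<Rightarrow> 3" assume \<sigma>: "\<sigma> \<in> carrier S3" "(x', y') = perm_act \<sigma> (x, y)"
    then show "\<exists>\<sigma>. bij \<sigma> \<and> (\<forall>i. x' $ i = x $ \<sigma> i) \<and> (\<forall>i. y' $ i = y $ \<sigma> i)"
      by (intro exI[of _ "Hilbert_Choice.inv \<sigma>"]) (simp add: carrier bij_imp_bij_inv)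
  next
    fix \<sigma> :: "3 \<Rightarrow> 3" assume "bij \<sigma>" "\<forall>i. x' $ i = x $ \<sigma> i" "\<forall>i. y' $ i = y $ \<sigma> i"
    then show "\<exists>\<sigma>\<in>carrier S3. (x', y') = perm_act \<sigma> (x, y)"
      by (intro bexI[of _ "Hilbert_Choice.inv \<sigma>"])
        (auto simp: carrier bij_imp_bij_inv inv_inv_eq vec_eq_iff)
  qed
  ultimately show ?thesis by simp
qed

section \<open>The quotient of the zero level of the moment map\<close>

text \<open>Cauchy's bound for the roots in terms of the coefficients.\<close>

lemma monic_root_bound:
  fixes p :: "complex poly"
  assumes "lead_coeff p = 1" "degree p > 0" "poly p z = 0"
  shows "cmod z \<le> 1 + (\<Sum>i<degree p. cmod (coeff p i))"
proof (cases "cmod z \<le> 1")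
  case True
  then show ?thesis by (simp add: add_increasing2 sum_nonneg)
next
  case False
  define n where "n = degree p - 1"
  have n: "degree p = Suc n" using assms(2) by (simp add: n_def)
  have "poly p z = (\<Sum>i<Suc n. coeff p i * z ^ i) + z ^ Suc n"
    using assms(1) n by (simp add: poly_altdef lessThan_Suc_atMost[symmetric])
  then have "z ^ Suc n = - (\<Sum>i<Suc n. coeff p i * z ^ i)"
    using assms(3) by (simp only: eq_neg_iff_add_eq_0 add.commute)
  then have "cmod z * cmod z ^ n = cmod (\<Sum>i<Suc n. coeff p i * z ^ i)"
    by (metis norm_minus_cancel norm_power power_Suc)
  also have "\<dots> \<le> (\<Sum>i<Suc n. cmod (coeff p i) * cmod z ^ n)"
    using False
    by (intro sum_norm_le) (auto simp: norm_mult norm_power intro!: mult_left_mono power_increasing)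
  also have "\<dots> = (\<Sum>i<Suc n. cmod (coeff p i)) * cmod z ^ n"
    by (simp only: sum_distrib_right)
  finally have "cmod z \<le> (\<Sum>i<Suc n. cmod (coeff p i))"
  proof (rule mult_right_le_imp_le)
    have "cmod z > 0" using False by linarith
    then show "0 < cmod z ^ n" by (rule zero_less_power)
  qed
  then show ?thesis by (simp add: n)
qed

lemma factor_root_bound:
  fixes z :: "'n::finite \<Rightarrow> complex"
  assumes "(\<Prod>i\<in>UNIV. [:- z i, 1:]) = p" "lead_coeff p = 1" "degree p > 0"
  shows "cmod (z i) \<le> 1 + (\<Sum>k<degree p. cmod (coeff p k))"
  by (rule monic_root_bound[OF assms(2,3)]) (auto simp: assms(1)[symmetric] poly_prod)

lemma continuous_on_vec_nth2:
  assumes "continuous_on S f"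
  shows "continuous_on S (\<lambda>x. f x $ i $ j)"
  by (intro continuous_on_component assms)

lemma continuous_on_matrix_mult:
  fixes f :: "'x::topological_space \<Rightarrow> 'a::real_normed_algebra_1^'n^'m" and g :: "'x \<Rightarrow> 'a^'k^'n"
  assumes "continuous_on S f" "continuous_on S g"
  shows "continuous_on S (\<lambda>x. f x ** g x)"
  unfolding matrix_matrix_mult_def
  by (intro continuous_on_vec_lambda continuous_on_sum continuous_on_mult continuous_on_vec_nth2 assms)

lemma continuous_on_mpow:
  fixes f :: "'x::topological_space \<Rightarrow> complex^'n^'n"
  assumes "continuous_on S f"
  shows "continuous_on S (\<lambda>x. mpow (f x) k)"
  by (induction k) (simp_all add: continuous_on_matrix_mult assms)

lemma continuous_on_trace:
  fixes f :: "'x::topological_space \<Rightarrow> 'a::real_normed_algebra_1^'n^'n"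
  assumes "continuous_on S f"
  shows "continuous_on S (\<lambda>x. trace (f x))"
  unfolding trace_def by (intro continuous_on_sum continuous_on_vec_nth2 assms)

lemma continuous_on_cmat:
  assumes "continuous_on S f" "continuous_on S g"
  shows "continuous_on S (\<lambda>x. cmat (f x) (g x))"
  unfolding cmat_def Complex_eq
  by (intro continuous_on_vec_lambda continuous_intros continuous_on_vec_nth2 assms)

lemma continuous_on_transpose:
  fixes f :: "'x::topological_space \<Rightarrow> 'a::topological_space^'n^'m"
  assumes "continuous_on S f"
  shows "continuous_on S (\<lambda>x. transpose (f x))"
  unfolding transpose_def by (intro continuous_on_vec_lambda continuous_on_vec_nth2 assms)

lemma norm_matrix_squared: "(norm (A :: real^'n^'m))\<^sup>2 = trace (A ** transpose A)"
  by (simp add: power2_norm_eq_inner inner_vec_def trace_def matrix_matrix_mult_def transpose_def)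

text \<open>The coordinates of the quotient: when the trace of \<open>A + \<i> B\<close> is zero, the remaining
  coefficients of its characteristic polynomial are polynomials in these traces, and conversely.\<close>

fun power_traces :: "(real^'n^'n) \<times> (real^'n^'n) \<Rightarrow> complex \<times> complex \<times> complex"
  where "power_traces (A, B) =
    (trace (mpow (cmat A B) 2), trace (mpow (cmat A B) 3), trace (mpow (cmat A B) 4))"

lemma \<mu>_zero_iff:
  "(A, B) \<in> \<mu>_zero \<longleftrightarrow> transpose A = A \<and> transpose B = B \<and> trace A = 0 \<and> trace B = 0 \<and>
    A ** B = B ** A"
  by (auto simp: \<mu>_zero_def V_def)

lemma closed_\<mu>_zero: "closed \<mu>_zero"
proof -
  have "\<mu>_zero = {x. transpose (fst x) = fst x} \<inter> {x. transpose (snd x) = snd x} \<inter>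
      {x. trace (fst x) = 0} \<inter> {x. trace (snd x) = 0} \<inter> {x. fst x ** snd x = snd x ** fst x}"
    by (auto simp: \<mu>_zero_iff)
  also have "closed \<dots>"
    by (intro closed_Int closed_Collect_eq continuous_on_transpose continuous_on_trace
        continuous_on_matrix_mult continuous_intros)
  finally show ?thesis .
qed

lemma \<mu>_zero_joint_eigenvalues:
  assumes "(A, B) \<in> \<mu>_zero"
  obtains z where "joint_eigenvalues A B z" "(\<Sum>i\<in>UNIV. z i) = 0"
    "power_traces (A, B) = (\<Sum>i\<in>UNIV. z i ^ 2, \<Sum>i\<in>UNIV. z i ^ 3, \<Sum>i\<in>UNIV. z i ^ 4)"
proof -
  have AB: "transpose A = A" "transpose B = B" "trace A = 0" "trace B = 0" "A ** B = B ** A"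
    using assms by (auto simp: \<mu>_zero_iff)
  obtain z where z: "joint_eigenvalues A B z"
    using joint_eigenvalues_exist[OF AB(1,2,5)] .
  have "(\<Sum>i\<in>UNIV. z i) = trace (cmat A B)"
    using power_trace_joint_eigenvalues[OF z, of 1] by simp
  also have "\<dots> = 0"
    using AB(3,4) by (simp add: trace_def complex_eq_iff)
  finally show thesis
    using that[OF z] by (simp add: power_trace_joint_eigenvalues[OF z])
qed

text \<open>The power traces are the power sums of the joint eigenvalues; by Newton's identities they
  determine the polynomial with these roots, hence the orbit.\<close>

lemma orbit_act4_eq_iff_power_traces:
  assumes "x \<in> \<mu>_zero" "y \<in> \<mu>_zero"
  shows "orbit SO act4 x = orbit SO act4 y \<longleftrightarrow> power_traces x = power_traces y"
proof -
  obtain A B A' B' where xy: "x = (A, B)" "y = (A', B')" by (cases x, cases y)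
  obtain z where z: "joint_eigenvalues A B z" "(\<Sum>i\<in>UNIV. z i) = 0"
    "power_traces (A, B) = (\<Sum>i\<in>UNIV. z i ^ 2, \<Sum>i\<in>UNIV. z i ^ 3, \<Sum>i\<in>UNIV. z i ^ 4)"
    using \<mu>_zero_joint_eigenvalues assms(1) xy(1) by blast
  obtain w where w: "joint_eigenvalues A' B' w" "(\<Sum>i\<in>UNIV. w i) = 0"
    "power_traces (A', B') = (\<Sum>i\<in>UNIV. w i ^ 2, \<Sum>i\<in>UNIV. w i ^ 3, \<Sum>i\<in>UNIV. w i ^ 4)"
    using \<mu>_zero_joint_eigenvalues assms(2) xy(2) by blast
  show ?thesis
  proof
    assume "orbit SO act4 x = orbit SO act4 y"
    then show "power_traces x = power_traces y"
      by (auto simp: xy orbit_act4_eq_iff rotation_matrix_def power_trace_orthogonal_conjugate)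
  next
    assume "power_traces x = power_traces y"
    then have "(\<Prod>i\<in>UNIV. [:- z i, 1:]) = (\<Prod>i\<in>UNIV. [:- w i, 1:])"
      unfolding xy z(3) w(3) linear_factors_4[OF z(2)] linear_factors_4[OF w(2)] by simp
    from joint_eigenvalues_eq_imp_conjugate[OF z(1) w(1) this]
    show "orbit SO act4 x = orbit SO act4 y"
      unfolding xy orbit_act4_eq_iff by blast
  qed
qed

text \<open>By the fundamental theorem of algebra every monic quartic without cubic term is the
  characteristic polynomial of some diagonal pair.\<close>

lemma power_traces_surj: "power_traces ` \<mu>_zero = UNIV"
proof -
  have "(p, q, r) \<in> power_traces ` \<mu>_zero" for p q r
  proof -
    define f :: "complex poly" where "f = [:p\<^sup>2 / 8 - r / 4, - q / 3, - p / 2, 0, 1:]"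
    have "lead_coeff f = 1" "degree f = CARD(4)" by (simp_all add: f_def)
    then obtain z :: "4 \<Rightarrow> complex" where z: "f = (\<Prod>i\<in>UNIV. [:- z i, 1:])"
      using monic_complex_poly_splits by blast
    have sum_zero: "(\<Sum>i\<in>UNIV. z i) = 0"
    proof -
      have "0 = - (z 1 + z 2 + z 3 + z 4)"
        using z unfolding f_def linear_factors_4_coeffs pCons_eq_iff by blast
      then show ?thesis unfolding sum_4 by (metis neg_0_equal_iff_equal)
    qed
    let ?x = "(diag (\<lambda>i. Re (z i)), diag (\<lambda>i. Im (z i)))"
    have "power_traces ?x = (p, q, r)"
      using z by (auto simp: f_def linear_factors_4[OF sum_zero]
          power_trace_joint_eigenvalues[OF joint_eigenvalues_diag])
    moreover have "?x \<in> \<mu>_zero"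
      using sum_zero unfolding \<mu>_zero_iff
      by (simp add: trace_diag diag_mult_diag mult.commute flip: Re_sum Im_sum)
    ultimately show ?thesis by (metis image_eqI)
  qed
  then show ?thesis by auto
qed

text \<open>The power traces bound the coefficients of the characteristic polynomial, these bound the joint
  eigenvalues, and the joint eigenvalues bound the Frobenius norms of \<open>A\<close> and \<open>B\<close>.\<close>

lemma power_traces_bounded: "bounded {x \<in> \<mu>_zero. norm (power_traces x) \<le> c}"
  unfolding bounded_iff
proof (intro exI ballI)
  fix x assume x: "x \<in> {x \<in> \<mu>_zero. norm (power_traces x) \<le> c}"
  obtain A B where AB: "x = (A, B)" by (cases x)
  define K where "K = 1 + (c\<^sup>2 + 3 * c)"
  obtain z where z: "joint_eigenvalues A B z" "(\<Sum>i\<in>UNIV. z i) = 0"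
    "power_traces (A, B) = (\<Sum>i\<in>UNIV. z i ^ 2, \<Sum>i\<in>UNIV. z i ^ 3, \<Sum>i\<in>UNIV. z i ^ 4)"
    using \<mu>_zero_joint_eigenvalues x AB by blast
  define p q r where "p = (\<Sum>i\<in>UNIV. z i ^ 2)" and "q = (\<Sum>i\<in>UNIV. z i ^ 3)"
    and "r = (\<Sum>i\<in>UNIV. z i ^ 4)"
  have "norm (p, q, r) \<le> c"
    using x z(3) AB by (simp add: p_def q_def r_def)
  then have pqr: "cmod p \<le> c" "cmod q \<le> c" "cmod r \<le> c"
    by (meson norm_fst_le norm_snd_le order_trans)+
  then have "c \<ge> 0" by (meson norm_ge_zero order_trans)
  have root: "cmod (z i) \<le> K" for i
  proof -
    have "cmod (z i) \<le> 1 + (cmod (p\<^sup>2 / 8 - r / 4) + cmod (q / 3) + cmod (p / 2))"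
      using factor_root_bound[OF linear_factors_4[OF z(2)], of i]
      by (simp add: p_def q_def r_def numeral_eq_Suc)
    also have "cmod (p\<^sup>2 / 8 - r / 4) \<le> cmod p ^ 2 + cmod r"
    proof -
      have "cmod (p\<^sup>2 / 8 - r / 4) \<le> cmod p ^ 2 / 8 + cmod r / 4"
        by (rule order_trans[OF norm_triangle_ineq4]) (simp add: norm_divide norm_power)
      then show ?thesis using zero_le_power2[of "cmod p"] norm_ge_zero[of r] by linarith
    qed
    also have "cmod p ^ 2 \<le> c\<^sup>2" using pqr(1) by (simp add: power_mono)
    also have "cmod (q / 3) \<le> c" using pqr(2) \<open>c \<ge> 0\<close> by (simp add: norm_divide)
    also have "cmod (p / 2) \<le> c" using pqr(1) \<open>c \<ge> 0\<close> by (simp add: norm_divide)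
    finally show ?thesis using pqr(3) by (simp add: K_def)
  qed
  have norm_le: "norm M \<le> 2 * K"
    if "M = U ** diag d ** transpose U" "orthogonal_matrix U" "\<And>i. \<bar>d i\<bar> \<le> cmod (z i)"
    for M U :: "real^4^4" and d
  proof -
    have "(norm M)\<^sup>2 = trace (U ** (diag d ** (transpose U ** U) ** diag d) ** transpose U)"
      by (simp add: norm_matrix_squared that(1) matrix_transpose_mul matrix_mul_assoc)
    also have "\<dots> = trace (diag d ** diag d)"
      using that(2) by (simp add: trace_conjugate orthogonal_matrix_def)
    also have "\<dots> = (\<Sum>i\<in>UNIV. \<bar>d i\<bar>\<^sup>2)"
      by (simp add: diag_mult_diag trace_diag power2_eq_square)
    also have "\<dots> \<le> (\<Sum>i\<in>(UNIV :: 4 set). K\<^sup>2)"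
      by (intro sum_mono power_mono order_trans[OF that(3) root]) simp
    also have "\<dots> = (2 * K)\<^sup>2" by (simp add: power_mult_distrib)
    finally show ?thesis
      by (rule power2_le_imp_le) (simp add: K_def \<open>c \<ge> 0\<close>)
  qed
  obtain U where U: "orthogonal_matrix U" "A = U ** diag (\<lambda>i. Re (z i)) ** transpose U"
    "B = U ** diag (\<lambda>i. Im (z i)) ** transpose U"
    using z(1) unfolding joint_eigenvalues_def by blast
  have "norm A \<le> 2 * K" "norm B \<le> 2 * K"
    by (rule norm_le[OF U(2,1) abs_Re_le_cmod], rule norm_le[OF U(3,1) abs_Im_le_cmod])
  then show "norm x \<le> 4 * (1 + (c\<^sup>2 + 3 * c))"
    using norm_Pair_le[of A B] unfolding AB K_def by linarith
qed

lemma orbit_space_\<mu>_zero_homeomorphic: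
  "orbit_space SO \<mu>_zero act4 homeomorphic_space (euclidean :: (complex \<times> complex \<times> complex) topology)"
proof (rule orbit_space_homeomorphic_euclidean)
  have eq: "power_traces = (\<lambda>x. (trace (mpow (cmat (fst x) (snd x)) 2),
      trace (mpow (cmat (fst x) (snd x)) 3), trace (mpow (cmat (fst x) (snd x)) 4)))"
    by (auto simp: fun_eq_iff)
  show "continuous_on \<mu>_zero power_traces"
    unfolding eq
    by (intro continuous_on_Pair continuous_on_trace continuous_on_mpow
        continuous_on_cmat continuous_intros)
qed (simp_all add: closed_\<mu>_zero power_traces_surj orbit_act4_eq_iff_power_traces power_traces_bounded)

section \<open>The quotient by the permutations of the coordinates\<close>

definition pair_coords :: "(real^3) \<times> (real^3) \<Rightarrow> 3 \<Rightarrow> complex"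
  where "pair_coords x i = Complex (fst x $ i) (snd x $ i)"

fun elementary_symmetric :: "(3 \<Rightarrow> complex) \<Rightarrow> complex \<times> complex \<times> complex"
  where "elementary_symmetric z =
    (z 1 + z 2 + z 3, z 1 * z 2 + z 1 * z 3 + z 2 * z 3, z 1 * z 2 * z 3)"

text \<open>Two copies of \<open>\<real>\<^sup>3\<close> form \<open>\<complex>\<^sup>3\<close>, and the elementary symmetric functions identify the
  unordered triples of complex numbers with the monic cubics, again by the fundamental theorem of
  algebra.\<close>

lemma orbit_space_S3_homeomorphic:
  "orbit_space S3 UNIV perm_act homeomorphic_space (euclidean :: (complex \<times> complex \<times> complex) topology)"
proof (rule orbit_space_homeomorphic_euclidean)
  let ?F = "\<lambda>x. elementary_symmetric (pair_coords x)"
  show "closed (UNIV :: ((real^3) \<times> (real^3)) set)" by simp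
  show "continuous_on UNIV ?F"
    unfolding elementary_symmetric.simps pair_coords_def Complex_eq by (intro continuous_intros)
  show "range ?F = UNIV"
  proof -
    have "(p, q, r) \<in> range ?F" for p q r
    proof -
      define f :: "complex poly" where "f = [:- r, q, - p, 1:]"
      have "lead_coeff f = 1" "degree f = CARD(3)" by (simp_all add: f_def)
      then obtain z :: "3 \<Rightarrow> complex" where z: "f = (\<Prod>i\<in>UNIV. [:- z i, 1:])"
        using monic_complex_poly_splits by blast
      have "pair_coords (\<chi> i. Re (z i), \<chi> i. Im (z i)) = z"
        by (simp add: fun_eq_iff pair_coords_def)
      then have "?F (\<chi> i. Re (z i), \<chi> i. Im (z i)) = (p, q, r)"
      proof -
        have "- r = - (z 1 * z 2 * z 3)" "q = z 1 * z 2 + z 1 * z 3 + z 2 * z 3"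
          "- p = - (z 1 + z 2 + z 3)"
          using z unfolding f_def linear_factors_3 pCons_eq_iff by blast+
        then show ?thesis
          using \<open>pair_coords _ = z\<close> by (simp only: elementary_symmetric.simps neg_equal_iff_equal)
      qed
      then show ?thesis by (metis rangeI)
    qed
    then show ?thesis by auto
  qed
  show "orbit S3 perm_act x = orbit S3 perm_act y \<longleftrightarrow> ?F x = ?F y" for x y
  proof -
    have "orbit S3 perm_act x = orbit S3 perm_act y \<longleftrightarrow>
        (\<exists>\<sigma>. bij \<sigma> \<and> (\<forall>i. pair_coords y i = pair_coords x (\<sigma> i)))"
      by (cases x; cases y) (auto simp: orbit_perm_act_eq_iff pair_coords_def)
    also have "\<dots> \<longleftrightarrow> (\<Prod>i\<in>UNIV. [:- pair_coords x i, 1:]) = (\<Prod>i\<in>UNIV. [:- pair_coords y i, 1:])"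
    proof
      assume "\<exists>\<sigma>. bij \<sigma> \<and> (\<forall>i. pair_coords y i = pair_coords x (\<sigma> i))"
      then obtain \<sigma> where "bij \<sigma>" "\<And>i. pair_coords y i = pair_coords x (\<sigma> i)" by blast
      then show "(\<Prod>i\<in>UNIV. [:- pair_coords x i, 1:]) = (\<Prod>i\<in>UNIV. [:- pair_coords y i, 1:])"
        using prod.reindex_bij_betw[of \<sigma> UNIV UNIV "\<lambda>i. [:- pair_coords x i, 1:]"] by simp
    next
      assume "(\<Prod>i\<in>UNIV. [:- pair_coords x i, 1:]) = (\<Prod>i\<in>UNIV. [:- pair_coords y i, 1:])"
      from linear_factors_eq_imp_permuted[OF this]
      show "\<exists>\<sigma>. bij \<sigma> \<and> (\<forall>i. pair_coords y i = pair_coords x (\<sigma> i))" by blast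
    qed
    also have "\<dots> \<longleftrightarrow> ?F x = ?F y"
      unfolding linear_factors_3 elementary_symmetric.simps pCons_eq_iff prod.inject neg_equal_iff_equal
      by blast
    finally show ?thesis .
  qed
  show "bounded {x \<in> UNIV. norm (?F x) \<le> c}" for c
    unfolding bounded_iff
  proof (intro exI ballI)
    fix x assume x: "x \<in> {x \<in> UNIV. norm (?F x) \<le> c}"
    obtain p q r where pqr: "?F x = (p, q, r)" using prod_cases3 by blast
    then have le: "cmod p \<le> c" "cmod q \<le> c" "cmod r \<le> c"
      using x norm_fst_le[of p "(q, r)"] norm_snd_le[of "(q, r)" p] norm_fst_le[of q r]
        norm_snd_le[of r q] by auto
    have factors: "(\<Prod>i\<in>UNIV. [:- pair_coords x i, 1:]) = [:- r, q, - p, 1:]"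
      using pqr unfolding linear_factors_3 elementary_symmetric.simps prod.inject by blast
    have root: "cmod (pair_coords x i) \<le> 1 + 3 * c" for i
    proof -
      have "cmod (pair_coords x i) \<le> 1 + (cmod r + cmod q + cmod p)"
        using factor_root_bound[OF factors, of i] by (simp add: numeral_eq_Suc)
      then show ?thesis using le by linarith
    qed
    have "norm v \<le> 3 * (1 + 3 * c)" if "\<And>i. \<bar>v $ i\<bar> \<le> cmod (pair_coords x i)" for v :: "real^3"
    proof -
      have "norm v \<le> (\<Sum>i\<in>UNIV. \<bar>v $ i\<bar>)" by (rule norm_le_l1_cart)
      also have "\<dots> \<le> (\<Sum>i\<in>(UNIV :: 3 set). 1 + 3 * c)"
        using that root by (intro sum_mono) (rule order_trans)
      finally show ?thesis by simp
    qed
    then have "norm (fst x) \<le> 3 * (1 + 3 * c)" "norm (snd x) \<le> 3 * (1 + 3 * c)"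
      using abs_Re_le_cmod[of "pair_coords x _"] abs_Im_le_cmod[of "pair_coords x _"]
      by (simp_all add: pair_coords_def)
    then show "norm x \<le> 6 * (1 + 3 * c)"
      using norm_Pair_le[of "fst x" "snd x"] by simp
  qed
qed

section \<open>Rotations preserve the nearly half-flat structures\<close>

lemma matrix_diff_mult_left:
  fixes A :: "'a::ring_1^'n^'m"
  shows "A ** (B - C) = A ** B - A ** C"
  by (simp add: vec_eq_iff matrix_matrix_mult_def algebra_simps sum_subtractf)

lemma matrix_diff_mult_right:
  fixes A B :: "'a::ring_1^'n^'m"
  shows "(A - B) ** C = A ** C - B ** C"
  by (simp add: vec_eq_iff matrix_matrix_mult_def algebra_simps sum_subtractf)

lemma matrix_add_mult_right:
  fixes A B :: "'a::ring_1^'n^'m"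
  shows "(A + B) ** C = A ** C + B ** C"
  by (simp add: vec_eq_iff matrix_matrix_mult_def algebra_simps sum.distrib)

lemma matrix_mult_scaleR_left: "(c *\<^sub>R A) ** B = c *\<^sub>R (A ** (B :: real^'k^'n))"
  by (simp add: vec_eq_iff matrix_matrix_mult_def sum_distrib_left mult.assoc)

lemma matrix_mult_scaleR_right: "A ** (c *\<^sub>R B) = c *\<^sub>R (A ** (B :: real^'k^'n))"
  by (simp add: vec_eq_iff matrix_matrix_mult_def sum_distrib_left mult.left_commute)

lemma Adj_3:
  fixes X :: "real^3^3"
  shows "Adj X = vector
    [vector [X$2$2 * X$3$3 - X$2$3 * X$3$2, X$1$3 * X$3$2 - X$1$2 * X$3$3, X$1$2 * X$2$3 - X$1$3 * X$2$2],
     vector [X$2$3 * X$3$1 - X$2$1 * X$3$3, X$1$1 * X$3$3 - X$1$3 * X$3$1, X$1$3 * X$2$1 - X$1$1 * X$2$3],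
     vector [X$2$1 * X$3$2 - X$2$2 * X$3$1, X$1$2 * X$3$1 - X$1$1 * X$3$2, X$1$1 * X$2$2 - X$1$2 * X$2$1]]"
  by (simp add: Adj_def vec_eq_iff forall_3 det_3 row_def axis_def)

lemma Adj_mult_3:
  fixes X Y :: "real^3^3"
  shows "Adj (X ** Y) = Adj Y ** Adj X"
  by (simp add: Adj_3 vec_eq_iff forall_3 matrix_matrix_mult_def sum_3 algebra_simps)

lemma Adj_rotation_matrix:
  assumes "rotation_matrix g"
  shows "Adj g = transpose g"
proof -
  have "Adj g = transpose g ** g ** Adj g"
    using assms by (simp add: rotation_matrix_def orthogonal_matrix_def)
  also have "\<dots> = transpose g ** (g ** Adj g)"
    by (simp only: matrix_mul_assoc)
  finally show ?thesis
    using assms by (simp add: matrix_mult_Adj rotation_matrix_def)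
qed

lemma Adj_rotate:
  fixes X :: "real^3^3"
  assumes "rotation_matrix g" "rotation_matrix h"
  shows "Adj (g ** X ** transpose h) = h ** Adj X ** transpose g"
  by (simp add: Adj_mult_3 Adj_rotation_matrix assms rotation_matrix_transpose matrix_mul_assoc)

lemma transpose_rotate: "transpose (g ** X ** transpose h) = h ** transpose X ** transpose g"
  for X :: "real^'n^'n"
  by (simp add: matrix_transpose_mul matrix_mul_assoc)

lemma rotate_mult_transpose:
  fixes X Y :: "real^'n^'n"
  assumes "orthogonal_matrix h"
  shows "(g ** X ** transpose h) ** transpose (k ** Y ** transpose h) = g ** (X ** transpose Y) ** transpose k"
proof -
  have "(g ** X ** transpose h) ** transpose (k ** Y ** transpose h)
      = g ** X ** (transpose h ** h) ** transpose Y ** transpose k"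
    by (simp only: matrix_transpose_mul transpose_transpose matrix_mul_assoc)
  also have "\<dots> = g ** (X ** transpose Y) ** transpose k"
    using assms by (simp only: orthogonal_matrix_def matrix_mul_rid matrix_mul_assoc)
  finally show ?thesis .
qed

lemma transpose_rotate_mult:
  fixes X Y :: "real^'n^'n"
  assumes "orthogonal_matrix g"
  shows "transpose (g ** X ** transpose h) ** (g ** Y ** transpose k) = h ** (transpose X ** Y) ** transpose k"
proof -
  have "transpose (g ** X ** transpose h) ** (g ** Y ** transpose k)
      = h ** transpose X ** (transpose g ** g) ** Y ** transpose k"
    by (simp only: matrix_transpose_mul transpose_transpose matrix_mul_assoc)
  also have "\<dots> = h ** (transpose X ** Y) ** transpose k"
    using assms by (simp only: orthogonal_matrix_def matrix_mul_rid matrix_mul_assoc)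
  finally show ?thesis .
qed

lemma nearly_half_flat_rotate:
  assumes QP: "(Q, P) \<in> nearly_half_flat lam a b" and g: "rotation_matrix g" and h: "rotation_matrix h"
  shows "(g ** Q ** transpose h, g ** P ** transpose h) \<in> nearly_half_flat lam a b"
proof -
  let ?Q = "g ** Q ** transpose h" and ?P = "g ** P ** transpose h"
  have orth: "orthogonal_matrix g" "orthogonal_matrix h" "det g = 1" "det h = 1"
    using g h by (auto simp: rotation_matrix_def)
  have Q1: "Q1 lam ?Q ?P = g ** Q1 lam Q P ** transpose h"
    by (simp add: Q1_def transpose_rotate Adj_rotate[OF h g] matrix_diff_mult_left
        matrix_diff_mult_right matrix_mult_scaleR_left matrix_mult_scaleR_right)
  have "- ?Q = g ** (- Q) ** transpose h"
    using matrix_diff_mult_left[of g 0 Q] matrix_diff_mult_right[of 0 "g ** Q" "transpose h"] by simp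
  then have Q2: "Q2 lam ?Q ?P = g ** Q2 lam Q P ** transpose h"
    by (simp add: Q2_def transpose_rotate Adj_rotate[OF h g] matrix_diff_mult_left
        matrix_diff_mult_right matrix_mult_scaleR_left matrix_mult_scaleR_right)
  have det: "det (g ** X ** transpose h) = det X" for X
    by (simp add: det_mul orth)
  have trace: "trace (h ** X ** transpose h) = trace X" for X
    using orth(2) by (simp add: trace_conjugate orthogonal_matrix_def)
  show ?thesis
    using QP unfolding nearly_half_flat_def mem_Collect_eq case_prod_conv Q1 Q2 det
      transpose_rotate_mult[OF orth(1)] rotate_mult_transpose[OF orth(2)] Adj_rotate[OF h h] trace
    by simp
qed

section \<open>The map \<open>\<Phi>\<close> in coordinates\<close>

text \<open>The coordinate form of \<open>\<Phi>\<close>, over any commutative ring: the complex case applies to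
  \<open>Q + \<i> P\<close>.\<close>

definition quaternion_matrix :: "'a::comm_ring_1^3^3 \<Rightarrow> 'a^4^4"
  where "quaternion_matrix X = vector
    [vector [- X$1$1 - X$2$2 - X$3$3, X$2$3 - X$3$2, X$3$1 - X$1$3, X$1$2 - X$2$1],
     vector [X$2$3 - X$3$2, X$2$2 + X$3$3 - X$1$1, - X$1$2 - X$2$1, - X$3$1 - X$1$3],
     vector [X$3$1 - X$1$3, - X$1$2 - X$2$1, X$1$1 + X$3$3 - X$2$2, - X$2$3 - X$3$2],
     vector [X$1$2 - X$2$1, - X$3$1 - X$1$3, - X$2$3 - X$3$2, X$1$1 + X$2$2 - X$3$3]]"

lemma vector_4 [simp]:
  "(vector [x, y, z, w] :: 'a::zero^4) $ 1 = x" "(vector [x, y, z, w] :: 'a^4) $ 2 = y"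
  "(vector [x, y, z, w] :: 'a^4) $ 3 = z" "(vector [x, y, z, w] :: 'a^4) $ 4 = w"
  unfolding vector_def by simp_all

lemma \<Phi>_eq_quaternion_matrix: "\<Phi> X = quaternion_matrix X"
  by (simp add: vec_eq_iff forall_4 \<Phi>_def quaternion_matrix_def sum_3 sum_4 L_def R_def
      matrix_matrix_mult_def matrix_def qmult_def imag_unit_def axis_def)

lemma cmat_quaternion_matrix:
  "cmat (quaternion_matrix Q) (quaternion_matrix P) = quaternion_matrix (cmat Q P)"
  by (simp add: vec_eq_iff forall_4 quaternion_matrix_def complex_eq_iff)

definition cofactor_matrix :: "'a::comm_ring_1^3^3 \<Rightarrow> 'a^3^3"
  where "cofactor_matrix X = vector
    [vector [X$2$2 * X$3$3 - X$2$3 * X$3$2, X$2$3 * X$3$1 - X$2$1 * X$3$3, X$2$1 * X$3$2 - X$2$2 * X$3$1],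
     vector [X$1$3 * X$3$2 - X$1$2 * X$3$3, X$1$1 * X$3$3 - X$1$3 * X$3$1, X$1$2 * X$3$1 - X$1$1 * X$3$2],
     vector [X$1$2 * X$2$3 - X$1$3 * X$2$2, X$1$3 * X$2$1 - X$1$1 * X$2$3, X$1$1 * X$2$2 - X$1$2 * X$2$1]]"

lemmas matrix_3_4_simps = vec_eq_iff forall_3 forall_4 matrix_matrix_mult_def sum_3 sum_4 trace_def
  transpose_def mat_def

text \<open>The \<open>L\<^sub>i\<close> square to \<open>-1\<close> and anticommute with each other, as do the \<open>R\<^sub>j\<close>, and the \<open>L\<^sub>i\<close>
  commute with the \<open>R\<^sub>j\<close>. In the square, the products \<open>L\<^sub>i R\<^sub>j L\<^sub>k R\<^sub>l\<close> with \<open>(i, j) = (k, l)\<close> give the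
  scalar term, those with exactly one coincidence cancel in pairs, and those with none give the
  two-by-two minors.\<close>

lemma quaternion_matrix_squared:
  "quaternion_matrix X ** quaternion_matrix X =
    mat (trace (transpose X ** X)) - 2 *s quaternion_matrix (cofactor_matrix X)"
  by (simp add: quaternion_matrix_def cofactor_matrix_def matrix_3_4_simps algebra_simps)


lemma trace_quaternion_matrix_mult:
  "trace (quaternion_matrix X ** quaternion_matrix Y) = 4 * trace (transpose X ** Y)"
  by (simp add: quaternion_matrix_def matrix_3_4_simps algebra_simps)

lemma trace_quaternion_matrix: "trace (quaternion_matrix X) = 0"
  by (simp add: quaternion_matrix_def matrix_3_4_simps)

lemma transpose_quaternion_matrix: "transpose (quaternion_matrix X) = quaternion_matrix X"
  by (simp add: quaternion_matrix_def matrix_3_4_simps)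

lemma trace_mult_cofactor_matrix: "trace (transpose X ** cofactor_matrix X) = 3 * det X"
  by (simp add: cofactor_matrix_def matrix_3_4_simps det_3 algebra_simps)

lemma trace_cofactor_matrix_squared:
  "2 * trace (transpose (cofactor_matrix X) ** cofactor_matrix X) =
    (trace (transpose X ** X))\<^sup>2 - trace ((transpose X ** X) ** (transpose X ** X))"
  by (simp add: cofactor_matrix_def matrix_3_4_simps power2_eq_square algebra_simps)

lemma quaternion_matrix_commute:
  fixes Q P :: "real^3^3"
  assumes "transpose Q ** P = transpose P ** Q" "Q ** transpose P = P ** transpose Q"
  shows "quaternion_matrix Q ** quaternion_matrix P = quaternion_matrix P ** quaternion_matrix Q"
  using assms by (simp add: quaternion_matrix_def matrix_3_4_simps algebra_simps)

text \<open>On a diagonal \<open>Z\<close> the eigenvalues are \<open>\<plusminus>z\<^sub>1 \<plusminus> z\<^sub>2 \<plusminus> z\<^sub>3\<close> with an odd number of minus signs. In general all three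
  traces come from the formula for the square, since that formula can be multiplied by itself.\<close>

lemma power_traces_quaternion_matrix:
  fixes Z :: "complex^3^3"
  defines "W \<equiv> transpose Z ** Z"
  shows "trace (mpow (quaternion_matrix Z) 2) = 4 * trace W"
    and "trace (mpow (quaternion_matrix Z) 3) = - 24 * det Z"
    and "trace (mpow (quaternion_matrix Z) 4) = 12 * (trace W)\<^sup>2 - 8 * trace (W ** W)"
proof -
  let ?M = "quaternion_matrix Z" and ?C = "quaternion_matrix (cofactor_matrix Z)"
  let ?I = "mat (trace W) :: complex^4^4"
  have sq: "?M ** ?M = ?I - 2 *s ?C"
    unfolding W_def by (rule quaternion_matrix_squared)
  show "trace (mpow ?M 2) = 4 * trace W"
    by (simp add: numeral_2_eq_2 trace_quaternion_matrix_mult W_def)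
  have scale: "trace (A ** (mat c - 2 *s B)) = c * trace A - 2 * trace (A ** B)"
    for A B :: "complex^4^4" and c
    by (simp add: matrix_3_4_simps algebra_simps)
  have "mpow ?M 3 = ?M ** (?M ** ?M)"
    by (simp add: numeral_3_eq_3)
  then have "trace (mpow ?M 3) = - 2 * (4 * trace (transpose Z ** cofactor_matrix Z))"
    by (simp add: sq scale trace_quaternion_matrix trace_quaternion_matrix_mult)
  then show "trace (mpow ?M 3) = - 24 * det Z"
    by (simp add: trace_mult_cofactor_matrix)
  have "mpow ?M 4 = (?M ** ?M) ** (?M ** ?M)"
    by (simp add: numeral_eq_Suc matrix_mul_assoc)
  also have "trace \<dots> = trace W * trace (?I - 2 *s ?C) - 2 * trace ((?I - 2 *s ?C) ** ?C)"
    unfolding sq scale ..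
  also have "trace (?I - 2 *s ?C) = 4 * trace W"
    using scale[of "mat 1" "trace W" ?C]
    by (simp add: trace_quaternion_matrix trace_I)
  also have "trace ((?I - 2 *s ?C) ** ?C) = - 2 * (4 * trace (transpose (cofactor_matrix Z) ** cofactor_matrix Z))"
    unfolding trace_mul_sym[of "?I - 2 *s ?C" ?C] scale
    by (simp add: trace_quaternion_matrix trace_quaternion_matrix_mult)
  also have "trace W * (4 * trace W) - 2 * (- 2 * (4 * trace (transpose (cofactor_matrix Z) ** cofactor_matrix Z)))
      = 4 * (trace W)\<^sup>2 + 8 * (2 * trace (transpose (cofactor_matrix Z) ** cofactor_matrix Z))"
    by (simp add: power2_eq_square)
  also have "\<dots> = 12 * (trace W)\<^sup>2 - 8 * trace (W ** W)"
    unfolding trace_cofactor_matrix_squared W_def[symmetric] by simp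
  finally show "trace (mpow ?M 4) = 12 * (trace W)\<^sup>2 - 8 * trace (W ** W)" .
qed

section \<open>Recovering the pair from its complex Gram matrix\<close>

text \<open>The difference \<open>E = C - D\<close> satisfies \<open>E C + D E = 0\<close>. If \<open>E\<close> were not zero, its
  range would contain an eigenvector. Evaluated there, the equation makes the eigenvalue zero, but
  the kernel of a symmetric matrix is orthogonal to its range.\<close>

lemma positive_square_root_unique:
  fixes C D :: "real^'n^'n"
  assumes sym: "transpose C = C" "transpose D = D"
    and C: "\<And>x. x \<noteq> 0 \<Longrightarrow> x \<bullet> (C *v x) > 0" and D: "\<And>x. x \<bullet> (D *v x) \<ge> 0"
    and eq: "C ** C = D ** D"
  shows "C = D"
proof (rule ccontr)
  assume "C \<noteq> D"
  define E where "E = C - D"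
  have symE: "transpose E = E"
    using sym by (simp add: E_def vec_eq_iff transpose_def)
  have zero: "E ** C + D ** E = 0"
    by (simp add: E_def matrix_diff_mult_left matrix_diff_mult_right eq)
  from \<open>C \<noteq> D\<close> obtain y where y: "E *v y \<noteq> 0"
    by (auto simp: E_def matrix_eq matrix_vector_mult_diff_rdistrib)
  have S: "subspace (range ((*v) E))"
    by (simp add: linear_subspace_image)
  obtain v c where v: "v \<in> range ((*v) E)" "norm v = 1" "E *v v = c *\<^sub>R v"
    using eigenvector_in_invariant_subspace[OF symE S _ y] by blast
  have "v \<bullet> ((E ** C + D ** E) *v v) = (E *v v) \<bullet> (C *v v) + (D *v v) \<bullet> (E *v v)"
    by (simp add: matrix_vector_mult_add_rdistrib inner_add_right symmetric_matrix_inner[OF symE]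
        symmetric_matrix_inner[OF sym(2)] flip: matrix_vector_mul_assoc)
  also have "\<dots> = c * (v \<bullet> (C *v v) + v \<bullet> (D *v v))"
    by (simp add: v(3) inner_commute algebra_simps)
  finally have "c * (v \<bullet> (C *v v) + v \<bullet> (D *v v)) = 0"
    by (simp add: zero)
  moreover have "v \<bullet> (C *v v) + v \<bullet> (D *v v) > 0"
    using C[of v] D[of v] v(2) by force
  ultimately have "E *v v = 0" using v(3) by simp
  moreover obtain x where "v = E *v x" using v(1) by blast
  ultimately have "v \<bullet> v = 0"
    using symmetric_matrix_inner[OF symE, of x v] by simp
  then show False using v(2) by simp
qed

definition commuting_pair :: "real^'n^'n \<Rightarrow> real^'n^'n \<Rightarrow> bool"
  where "commuting_pair Q P \<longleftrightarrow> det P \<noteq> 0 \<and> transpose Q ** P = transpose P ** Q \<and>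
    Q ** transpose P = P ** transpose Q"

lemma gram_inner: "x \<bullet> ((transpose X ** X) *v x) = (norm (X *v x))\<^sup>2"
  for X :: "real^'n^'n"
  by (metis dot_lmul_matrix inner_commute matrix_vector_mul_assoc power2_norm_eq_inner
      transpose_matrix_vector)

lemma gram_sum_positive:
  fixes Q P :: "real^'n^'n"
  assumes "det P \<noteq> 0" "x \<noteq> 0"
  shows "x \<bullet> ((transpose Q ** Q + transpose P ** P) *v x) > 0"
proof -
  have "P *v x \<noteq> 0"
    using assms by (metis invertible_det_nz invertible_def matrix_left_invertible_ker)
  then show ?thesis
    by (simp add: matrix_vector_mult_add_rdistrib inner_add_right gram_inner add_nonneg_pos)
qed

lemma commuting_pair_relations:
  fixes Q P :: "real^'n^'n"
  assumes "transpose Q ** P = transpose P ** Q" "Q ** transpose P = P ** transpose Q"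
  defines "X \<equiv> transpose Q ** Q" and "Y \<equiv> transpose P ** P" and "T \<equiv> transpose Q ** P"
  shows "T ** T = X ** Y" "T ** T = Y ** X" "X ** T = T ** X" "Y ** T = T ** Y"
proof -
  have "T ** T = transpose Q ** (P ** transpose Q) ** P"
    by (simp only: T_def matrix_mul_assoc)
  also have "\<dots> = X ** Y"
    by (simp only: X_def Y_def matrix_mul_assoc flip: assms(2))
  finally show "T ** T = X ** Y" .
  have "T ** T = transpose P ** (Q ** transpose P) ** Q"
    by (simp only: T_def assms(1) matrix_mul_assoc)
  also have "\<dots> = Y ** X"
    by (simp only: X_def Y_def assms(2) matrix_mul_assoc)
  finally show "T ** T = Y ** X" .
  have "T ** X = transpose Q ** (P ** transpose Q) ** Q"
    by (simp only: T_def X_def matrix_mul_assoc)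
  also have "\<dots> = transpose Q ** Q ** (transpose P ** Q)"
    by (simp only: matrix_mul_assoc flip: assms(2))
  also have "\<dots> = X ** T"
    by (simp only: T_def X_def assms(1))
  finally show "X ** T = T ** X" ..
  have "Y ** T = transpose P ** (P ** transpose Q) ** P"
    by (simp only: T_def Y_def matrix_mul_assoc)
  also have "\<dots> = (transpose P ** Q) ** Y"
    by (simp only: Y_def matrix_mul_assoc flip: assms(2))
  also have "\<dots> = T ** Y"
    by (simp only: T_def assms(1))
  finally show "Y ** T = T ** Y" .
qed

lemma gram_cmat:
  "transpose (cmat Q P) ** cmat Q P =
    cmat (transpose Q ** Q - transpose P ** P) (transpose Q ** P + transpose P ** Q)"
  by (simp add: transpose_cmat cmat_mult)

lemma det_cmat_real_3: "det (cmat A 0 :: complex^3^3) = of_real (det A)"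
  by (simp add: det_3 complex_eq_iff)

text \<open>With \<open>Z = Q + \<i> P\<close>, the product of the conjugate transpose of \<open>Z\<close> with \<open>Z\<close> is the positive definite
  real matrix \<open>Q\<^sup>T Q + P\<^sup>T P\<close>.\<close>

lemma det_cmat_nonzero:
  fixes Q P :: "real^3^3"
  assumes "det P \<noteq> 0" "transpose Q ** P = transpose P ** Q"
  shows "det (cmat Q P) \<noteq> 0"
proof
  assume "det (cmat Q P) = 0"
  let ?N = "transpose Q ** Q + transpose P ** P"
  have "(- transpose P) ** M = - (transpose P ** M)" for M :: "real^3^3"
    using matrix_diff_mult_right[of 0 "transpose P" M] by simp
  then have "cmat (transpose Q) (- transpose P) ** cmat Q P = cmat ?N 0"
    by (simp add: cmat_mult assms(2))
  then have "of_real (det ?N) = det (cmat (transpose Q) (- transpose P)) * det (cmat Q P)"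
    by (metis det_cmat_real_3 det_mul)
  with \<open>det (cmat Q P) = 0\<close> have "det ?N = 0" by simp
  then obtain x where "x \<noteq> 0" "?N *v x = 0"
    by (metis invertible_det_nz invertible_left_inverse matrix_left_invertible_ker)
  then show False
    using gram_sum_positive[OF assms(1), of x Q] by simp
qed

section \<open>Orbits of nearly half-flat structures\<close>

text \<open>With \<open>Z = Q + \<i> P\<close> and \<open>W = Z\<^sup>T Z\<close> (transposed, not conjugated), rotations act by
  \<open>Z \<mapsto> g Z h\<^sup>T\<close> and \<open>W \<mapsto> h W h\<^sup>T\<close>.\<close>

definition bi_rotation_invariants :: "(real^3^3) \<times> (real^3^3) \<Rightarrow> complex \<times> complex \<times> complex"
  where "bi_rotation_invariants x = (let Z = cmat (fst x) (snd x); W = transpose Z ** Z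
    in (trace W, trace (W ** W), det Z))"

lemma bi_rotation_invariants_rotate:
  assumes "rotation_matrix g" "rotation_matrix h"
  shows "bi_rotation_invariants (g ** Q ** transpose h, g ** P ** transpose h) = bi_rotation_invariants (Q, P)"
proof -
  let ?Z = "cmat Q P" and ?g = "cmat g 0" and ?h = "cmat h 0" and ?k = "cmat (transpose h) 0"
  have k: "?k = transpose ?h" by (simp add: transpose_cmat_real)
  have orth: "transpose ?g ** ?g = mat 1" "transpose ?h ** ?h = mat 1"
    using assms by (simp_all add: rotation_matrix_def transpose_cmat_real cmat_orthogonal)
  have "transpose (?g ** ?Z ** ?k) ** (?g ** ?Z ** ?k) =
      ?h ** transpose ?Z ** (transpose ?g ** ?g) ** ?Z ** transpose ?h"
    by (simp only: k matrix_transpose_mul transpose_transpose matrix_mul_assoc)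
  also have "\<dots> = ?h ** (transpose ?Z ** ?Z) ** transpose ?h"
    by (simp only: orth matrix_mul_rid matrix_mul_assoc)
  finally have W: "transpose (?g ** ?Z ** ?k) ** (?g ** ?Z ** ?k) = ?h ** (transpose ?Z ** ?Z) ** transpose ?h" .
  show ?thesis
    unfolding bi_rotation_invariants_def Let_def fst_conv snd_conv cmat_real_mult W
      conjugate_mult[OF orth(2)]
    by (simp add: trace_conjugate orth det_mul det_cmat_real_3 assms[unfolded rotation_matrix_def])
qed

lemma power_traces_\<Phi>:
  "power_traces (\<Phi> Q, \<Phi> P) =
    (let (s, t, d) = bi_rotation_invariants (Q, P) in (4 * s, - 24 * d, 12 * s\<^sup>2 - 8 * t))"
  by (simp add: \<Phi>_eq_quaternion_matrix cmat_quaternion_matrix power_traces_quaternion_matrix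
      bi_rotation_invariants_def Let_def)

text \<open>This takes the place of the double cover \<open>SO(4) \<rightarrow> SO(3) \<times> SO(3)\<close>: the invariants that classify
  the orbits on the two sides are polynomials in each other.\<close>

lemma power_traces_\<Phi>_eq_iff:
  "power_traces (\<Phi> Q, \<Phi> P) = power_traces (\<Phi> Q', \<Phi> P') \<longleftrightarrow>
    bi_rotation_invariants (Q, P) = bi_rotation_invariants (Q', P')"
  unfolding power_traces_\<Phi> by (cases "bi_rotation_invariants (Q, P)"; cases "bi_rotation_invariants (Q', P')") auto

lemma nearly_half_flat_commuting_pair:
  "(Q, P) \<in> nearly_half_flat lam a b \<Longrightarrow> commuting_pair Q P"
  by (simp add: nearly_half_flat_def commuting_pair_def)

lemma \<Phi>_in_\<mu>_zero:
  assumes "commuting_pair Q P"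
  shows "(\<Phi> Q, \<Phi> P) \<in> \<mu>_zero"
  using assms unfolding \<mu>_zero_iff \<Phi>_eq_quaternion_matrix commuting_pair_def
  by (simp add: transpose_quaternion_matrix trace_quaternion_matrix quaternion_matrix_commute)

text \<open>Here \<open>A\<close> and \<open>B\<close> are the real and imaginary parts of \<open>Z\<^sup>T Z\<close> for \<open>Z = Q + \<i> P\<close>, and
  \<open>N\<close> is \<open>Z\<^sup>* Z\<close>. For diagonal \<open>Z\<close> the last equation says
  \<open>\<bar>z\<bar>\<^sup>4 = (Re (z\<^sup>2))\<^sup>2 + (Im (z\<^sup>2))\<^sup>2\<close> for each diagonal entry \<open>z\<close>.\<close>

lemma gram_parts:
  fixes Q P :: "real^'n^'n"
  assumes "commuting_pair Q P"
  defines "A \<equiv> transpose Q ** Q - transpose P ** P" and "B \<equiv> transpose Q ** P + transpose P ** Q"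
    and "N \<equiv> transpose Q ** Q + transpose P ** P"
  shows "transpose A = A" "transpose B = B" "transpose N = N" "A ** B = B ** A" "N ** N = A ** A + B ** B"
proof -
  note PQ = assms(1)[unfolded commuting_pair_def]
  let ?X = "transpose Q ** Q" and ?Y = "transpose P ** P" and ?T = "transpose Q ** P"
  have B: "B = ?T + ?T" using PQ by (simp add: B_def)
  have rel: "?T ** ?T = ?X ** ?Y" "?Y ** ?X = ?X ** ?Y" "?X ** ?T = ?T ** ?X" "?Y ** ?T = ?T ** ?Y"
    using commuting_pair_relations[of Q P] PQ by auto
  have transpose_add: "transpose (M + M') = transpose M + transpose M'"
    and transpose_diff: "transpose (M - M') = transpose M - transpose M'" for M M' :: "real^'n^'n"
    by (simp_all add: vec_eq_iff transpose_def)
  show "transpose A = A" "transpose B = B" "transpose N = N"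
    by (simp_all add: A_def B_def N_def transpose_add transpose_diff matrix_transpose_mul add.commute)
  show "A ** B = B ** A"
    unfolding A_def B matrix_diff_mult_right matrix_diff_mult_left matrix_add_ldistrib
      matrix_add_mult_right rel by simp
  show "N ** N = A ** A + B ** B"
    unfolding A_def B N_def matrix_diff_mult_right matrix_diff_mult_left matrix_add_ldistrib
      matrix_add_mult_right rel by (simp add: algebra_simps)
qed

text \<open>The matrix \<open>N = Q\<^sup>T Q + P\<^sup>T P\<close> is the positive square root of \<open>A\<^sup>2 + B\<^sup>2\<close>, so conjugating \<open>A\<close> and \<open>B\<close> by
  \<open>h\<close> conjugates \<open>N\<close> as well, and with it \<open>P\<^sup>T P\<close> and \<open>P\<^sup>T Q\<close>. The only possible \<open>g\<close> is then \<open>P' h P\<^sup>-\<^sup>1\<close>, and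
  these two conjugacies say that it is orthogonal and carries \<open>Q\<close> to \<open>Q'\<close>.\<close>

lemma commuting_pair_rotate_if_gram_conjugate:
  fixes Q P Q' P' :: "real^'n^'n"
  assumes QP: "commuting_pair Q P" and QP': "commuting_pair Q' P'"
    and h: "orthogonal_matrix h"
    and A: "transpose Q' ** Q' - transpose P' ** P' = h ** (transpose Q ** Q - transpose P ** P) ** transpose h"
    and B: "transpose Q' ** P' + transpose P' ** Q' = h ** (transpose Q ** P + transpose P ** Q) ** transpose h"
  obtains g where "orthogonal_matrix g" "Q' = g ** Q ** transpose h" "P' = g ** P ** transpose h"
proof -
  define A0 B0 N where "A0 = transpose Q ** Q - transpose P ** P"
    and "B0 = transpose Q ** P + transpose P ** Q" and "N = transpose Q ** Q + transpose P ** P"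
  define N' where "N' = transpose Q' ** Q' + transpose P' ** P'"
  have hh: "transpose h ** h = mat 1" "h ** transpose h = mat 1"
    using h by (auto simp: orthogonal_matrix_def)
  note conj_mult = conjugate_mult[OF hh(1)]
  have "N' = h ** N ** transpose h"
  proof (rule positive_square_root_unique)
    show "transpose N' = N'" unfolding N'_def by (rule gram_parts(3)[OF QP'])
    show "transpose (h ** N ** transpose h) = h ** N ** transpose h"
      unfolding transpose_rotate N_def gram_parts(3)[OF QP] ..
    show "x \<bullet> (N' *v x) > 0" if "x \<noteq> 0" for x
      unfolding N'_def using QP' that by (intro gram_sum_positive) (auto simp: commuting_pair_def)
    show "x \<bullet> ((h ** N ** transpose h) *v x) \<ge> 0" for x
    proof -
      have "x \<bullet> ((h ** N ** transpose h) *v x) = (transpose h *v x) \<bullet> (N *v (transpose h *v x))"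
        using dot_lmul_matrix[of x h "N *v (transpose h *v x)"]
        by (simp flip: matrix_vector_mul_assoc transpose_matrix_vector)
      also have "\<dots> \<ge> 0"
        by (simp add: N_def matrix_vector_mult_add_rdistrib inner_add_right gram_inner del: transpose_matrix_vector)
      finally show ?thesis .
    qed
    have NN: "N ** N = A0 ** A0 + B0 ** B0"
      unfolding N_def A0_def B0_def by (rule gram_parts(5)[OF QP])
    have "N' ** N' = h ** (A0 ** A0) ** transpose h + h ** (B0 ** B0) ** transpose h"
      unfolding N'_def gram_parts(5)[OF QP'] A B conj_mult A0_def B0_def ..
    also have "\<dots> = h ** (N ** N) ** transpose h"
      by (simp only: NN matrix_add_ldistrib matrix_add_mult_right)
    finally show "N' ** N' = (h ** N ** transpose h) ** (h ** N ** transpose h)"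
      by (simp only: conj_mult)
  qed
  then have "N' - h ** A0 ** transpose h = h ** (N - A0) ** transpose h"
    by (simp add: matrix_diff_mult_left matrix_diff_mult_right)
  moreover have "N' - h ** A0 ** transpose h = 2 *\<^sub>R (transpose P' ** P')"
    unfolding A0_def A[symmetric] N'_def by (simp add: scaleR_2)
  moreover have "N - A0 = 2 *\<^sub>R (transpose P ** P)"
    by (simp add: N_def A0_def scaleR_2)
  ultimately have PP: "transpose P' ** P' = h ** (transpose P ** P) ** transpose h"
    by (simp add: matrix_mult_scaleR_left matrix_mult_scaleR_right)
  have "2 *\<^sub>R (transpose P' ** Q') = h ** (2 *\<^sub>R (transpose P ** Q)) ** transpose h"
    using B QP QP' by (simp add: commuting_pair_def scaleR_2)
  then have PQ: "transpose P' ** Q' = h ** (transpose P ** Q) ** transpose h"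
    by (simp add: matrix_mult_scaleR_left matrix_mult_scaleR_right)
  obtain R where R: "P ** R = mat 1" "R ** P = mat 1"
    using QP invertible_det_nz[of P] by (auto simp: commuting_pair_def invertible_def)
  obtain R' where R': "R' ** transpose P' = mat 1"
    using QP' invertible_det_nz[of "transpose P'"] by (auto simp: commuting_pair_def invertible_def)
  define g where "g = P' ** h ** R"
  have P'g: "transpose P' ** g = h ** transpose P"
  proof -
    have "transpose P' ** g = transpose P' ** P' ** h ** R"
      by (simp only: g_def matrix_mul_assoc)
    also have "\<dots> = h ** transpose P ** P ** (transpose h ** h) ** R"
      by (simp only: PP matrix_mul_assoc)
    also have "\<dots> = h ** transpose P ** (P ** R)"
      by (simp only: hh matrix_mul_rid matrix_mul_assoc)
    finally show ?thesis by (simp only: R matrix_mul_rid)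
  qed
  show thesis
  proof
    have "transpose g ** g = transpose R ** transpose h ** (transpose P' ** g)"
      by (simp only: g_def matrix_transpose_mul matrix_mul_assoc)
    also have "\<dots> = transpose R ** (transpose h ** h) ** transpose P"
      by (simp only: P'g matrix_mul_assoc)
    also have "\<dots> = transpose (P ** R)"
      by (simp only: hh matrix_mul_rid matrix_transpose_mul)
    finally show "orthogonal_matrix g"
      by (simp add: R orthogonal_matrix)
    have "g ** P ** transpose h = P' ** h ** (R ** P) ** transpose h"
      by (simp only: g_def matrix_mul_assoc)
    also have "\<dots> = P' ** (h ** transpose h)"
      by (simp only: R matrix_mul_rid matrix_mul_assoc)
    finally show "P' = g ** P ** transpose h"
      by (simp only: hh matrix_mul_rid)
    have "transpose P' ** (g ** Q ** transpose h) = transpose P' ** Q'"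
      unfolding PQ matrix_mul_assoc P'g ..
    then have "R' ** transpose P' ** (g ** Q ** transpose h) = R' ** transpose P' ** Q'"
      by (simp only: matrix_mul_assoc[symmetric])
    then show "Q' = g ** Q ** transpose h"
      by (simp only: R' matrix_mul_lid)
  qed
qed

text \<open>The invariants give the characteristic polynomial of \<open>A + \<i> B = Z\<^sup>T Z\<close>, whose determinant is
  the square of \<open>det Z\<close>; this provides \<open>h\<close> and an orthogonal \<open>g\<close>. The value of \<open>det Z \<noteq> 0\<close> itself, not
  only its square, excludes \<open>det g = -1\<close>.\<close>

lemma bi_rotation_invariants_eq_imp_rotate:
  fixes Q P Q' P' :: "real^3^3"
  assumes QP: "commuting_pair Q P" and QP': "commuting_pair Q' P'"
    and eq: "bi_rotation_invariants (Q, P) = bi_rotation_invariants (Q', P')"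
  obtains g h where "rotation_matrix g" "rotation_matrix h"
    "Q' = g ** Q ** transpose h" "P' = g ** P ** transpose h"
proof -
  define A B where "A = transpose Q ** Q - transpose P ** P" and "B = transpose Q ** P + transpose P ** Q"
  define A' B' where "A' = transpose Q' ** Q' - transpose P' ** P'" and "B' = transpose Q' ** P' + transpose P' ** Q'"
  have W: "transpose (cmat Q P) ** cmat Q P = cmat A B"
    "transpose (cmat Q' P') ** cmat Q' P' = cmat A' B'"
    by (simp_all add: gram_cmat A_def B_def A'_def B'_def)
  have inv: "trace (cmat A B) = trace (cmat A' B')"
    "trace (cmat A B ** cmat A B) = trace (cmat A' B' ** cmat A' B')"
    "det (cmat Q P) = det (cmat Q' P')"
    using eq by (auto simp: bi_rotation_invariants_def Let_def W)
  have "det (cmat A B) = det (cmat A' B')"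
    unfolding W[symmetric] det_mul det_transpose inv(3) ..
  obtain z where z: "joint_eigenvalues A B z"
    using joint_eigenvalues_exist gram_parts[OF QP] unfolding A_def B_def by metis
  obtain w where w: "joint_eigenvalues A' B' w"
    using joint_eigenvalues_exist gram_parts[OF QP'] unfolding A'_def B'_def by metis
  have s1: "z 1 + z 2 + z 3 = w 1 + w 2 + w 3"
    using inv(1) power_trace_joint_eigenvalues[OF z, of 1] power_trace_joint_eigenvalues[OF w, of 1]
    by (simp add: sum_3)
  have s2: "z 1 ^ 2 + z 2 ^ 2 + z 3 ^ 2 = w 1 ^ 2 + w 2 ^ 2 + w 3 ^ 2"
    using inv(2) power_trace_joint_eigenvalues[OF z, of 2] power_trace_joint_eigenvalues[OF w, of 2]
    by (simp add: sum_3 numeral_2_eq_2)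
  have newton: "2 * (a * b + a * c + b * c) = (a + b + c)\<^sup>2 - (a ^ 2 + b ^ 2 + c ^ 2)" for a b c :: complex
    by (simp add: power2_eq_square algebra_simps)
  have "2 * (z 1 * z 2 + z 1 * z 3 + z 2 * z 3) = 2 * (w 1 * w 2 + w 1 * w 3 + w 2 * w 3)"
    unfolding newton s1 s2 ..
  then have e2: "z 1 * z 2 + z 1 * z 3 + z 2 * z 3 = w 1 * w 2 + w 1 * w 3 + w 2 * w 3"
    by (simp only: mult_cancel_left) simp
  have e3: "z 1 * z 2 * z 3 = w 1 * w 2 * w 3"
    using \<open>det (cmat A B) = _\<close> det_joint_eigenvalues[OF z] det_joint_eigenvalues[OF w]
    by (simp only: prod_UNIV_3)
  have "(\<Prod>i\<in>UNIV. [:- z i, 1:]) = (\<Prod>i\<in>UNIV. [:- w i, 1:])"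
    unfolding linear_factors_3 s1 e2 e3 ..
  from joint_eigenvalues_eq_imp_conjugate[OF z w this]
  obtain h where h: "rotation_matrix h" "A' = h ** A ** transpose h" "B' = h ** B ** transpose h" .
  then have "orthogonal_matrix h" by (simp add: rotation_matrix_def)
  from commuting_pair_rotate_if_gram_conjugate[OF QP QP' this h(2,3)[unfolded A_def B_def A'_def B'_def]]
  obtain g where g: "orthogonal_matrix g" "Q' = g ** Q ** transpose h" "P' = g ** P ** transpose h" .
  have "det (cmat Q' P') = of_real (det g) * det (cmat Q P)"
    using h(1) by (simp add: g(2,3) cmat_real_mult det_mul det_cmat_real_3 rotation_matrix_def)
  moreover have "det (cmat Q P) \<noteq> 0"
    using QP by (intro det_cmat_nonzero) (auto simp: commuting_pair_def)
  ultimately have "det g = 1"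
    using inv(3) by simp
  with g h(1) show thesis
    by (intro that) (auto simp: rotation_matrix_def)
qed

lemma orbits_correspond:
  assumes "(Q, P) \<in> nearly_half_flat lam a b" "(Q', P') \<in> nearly_half_flat lam a b"
  shows "orbit (SO \<times>\<times> SO) act33 (Q, P) = orbit (SO \<times>\<times> SO) act33 (Q', P') \<longleftrightarrow>
    orbit SO act4 (\<Phi> Q, \<Phi> P) = orbit SO act4 (\<Phi> Q', \<Phi> P')"
proof -
  have comm: "commuting_pair Q P" "commuting_pair Q' P'"
    using assms by (auto intro: nearly_half_flat_commuting_pair)
  have "orbit (SO \<times>\<times> SO) act33 (Q, P) = orbit (SO \<times>\<times> SO) act33 (Q', P') \<longleftrightarrow>
      bi_rotation_invariants (Q, P) = bi_rotation_invariants (Q', P')"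
    unfolding orbit_act33_eq_iff
    using bi_rotation_invariants_eq_imp_rotate[OF comm] bi_rotation_invariants_rotate by metis
  also have "\<dots> \<longleftrightarrow> orbit SO act4 (\<Phi> Q, \<Phi> P) = orbit SO act4 (\<Phi> Q', \<Phi> P')"
    unfolding orbit_act4_eq_iff_power_traces[OF \<Phi>_in_\<mu>_zero[OF comm(1)] \<Phi>_in_\<mu>_zero[OF comm(2)]]
      power_traces_\<Phi>_eq_iff ..
  finally show ?thesis .
qed

theorem corollary4p2:
  fixes lam a b :: real
  assumes "lam \<noteq> 0"
  shows
    "(\<forall>g \<in> carrier ((SO :: (real^3^3) monoid) \<times>\<times> (SO :: (real^3^3) monoid)).
        act33 g ` nearly_half_flat lam a b \<subseteq> nearly_half_flat lam a b) \<and>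
     (\<forall>(Q, P) \<in> nearly_half_flat lam a b. (\<Phi> Q, \<Phi> P) \<in> \<mu>_zero) \<and>
     (\<exists>f. f \<in> orbits (SO \<times>\<times> SO) (nearly_half_flat lam a b) act33 \<rightarrow> orbits SO \<mu>_zero act4 \<and>
        (\<forall>(Q, P) \<in> nearly_half_flat lam a b.
           f (orbit (SO \<times>\<times> SO) act33 (Q, P)) = orbit SO act4 (\<Phi> Q, \<Phi> P)) \<and>
        inj_on f (orbits (SO \<times>\<times> SO) (nearly_half_flat lam a b) act33)) \<and>
     orbit_space SO \<mu>_zero act4 homeomorphic_space orbit_space S3 UNIV perm_act"
proof (intro conjI)
  let ?H = "nearly_half_flat lam a b"
  let ?orb33 = "orbit (SO \<times>\<times> SO) act33" and ?orb4 = "\<lambda>(Q, P). orbit SO act4 (\<Phi> Q, \<Phi> P)"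
  show "\<forall>g \<in> carrier ((SO :: (real^3^3) monoid) \<times>\<times> (SO :: (real^3^3) monoid)). act33 g ` ?H \<subseteq> ?H"
    by (auto simp: SO_def intro: nearly_half_flat_rotate)
  show \<mu>_zero: "\<forall>(Q, P) \<in> ?H. (\<Phi> Q, \<Phi> P) \<in> \<mu>_zero"
    by (auto intro: \<Phi>_in_\<mu>_zero nearly_half_flat_commuting_pair)
  have iff: "?orb33 x = ?orb33 y \<longleftrightarrow> ?orb4 x = ?orb4 y" if "x \<in> ?H" "y \<in> ?H" for x y
    using that by (cases x; cases y) (simp add: orbits_correspond)
  define f where "f = (\<lambda>\<O>. ?orb4 (SOME x. x \<in> ?H \<and> ?orb33 x = \<O>))"
  have f: "f (?orb33 x) = ?orb4 x" if "x \<in> ?H" for x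
  proof -
    define y where "y = (SOME y. y \<in> ?H \<and> ?orb33 y = ?orb33 x)"
    have y: "y \<in> ?H \<and> ?orb33 y = ?orb33 x"
      unfolding y_def by (rule someI[of _ x]) (simp add: that)
    have "f (?orb33 x) = ?orb4 y"
      by (simp only: f_def y_def)
    also have "\<dots> = ?orb4 x"
      using iff[of y x] y that by simp
    finally show ?thesis .
  qed
  have "f \<in> orbits (SO \<times>\<times> SO) ?H act33 \<rightarrow> orbits SO \<mu>_zero act4"
  proof
    fix \<O> assume "\<O> \<in> orbits (SO \<times>\<times> SO) ?H act33"
    then obtain Q P where QP: "(Q, P) \<in> ?H" "\<O> = ?orb33 (Q, P)"
      unfolding orbits_def by auto
    then have "f \<O> = orbit SO act4 (\<Phi> Q, \<Phi> P)" using f[OF QP(1)] by simp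
    moreover have "(\<Phi> Q, \<Phi> P) \<in> \<mu>_zero" using \<mu>_zero QP(1) by blast
    ultimately show "f \<O> \<in> orbits SO \<mu>_zero act4" unfolding orbits_def by blast
  qed
  moreover have "\<forall>(Q, P) \<in> ?H. f (?orb33 (Q, P)) = orbit SO act4 (\<Phi> Q, \<Phi> P)"
    using f by fastforce
  moreover have "inj_on f (orbits (SO \<times>\<times> SO) ?H act33)"
  proof (rule inj_onI)
    fix \<O> \<O>' assume "\<O> \<in> orbits (SO \<times>\<times> SO) ?H act33" "\<O>' \<in> orbits (SO \<times>\<times> SO) ?H act33"
    then obtain x y where xy: "x \<in> ?H" "\<O> = ?orb33 x" "y \<in> ?H" "\<O>' = ?orb33 y"
      unfolding orbits_def by blast
    assume "f \<O> = f \<O>'"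
    then show "\<O> = \<O>'" using iff[OF xy(1,3)] f[OF xy(1)] f[OF xy(3)] xy(2,4) by simp
  qed
  ultimately show "\<exists>f. f \<in> orbits (SO \<times>\<times> SO) ?H act33 \<rightarrow> orbits SO \<mu>_zero act4 \<and>
        (\<forall>(Q, P) \<in> ?H. f (?orb33 (Q, P)) = orbit SO act4 (\<Phi> Q, \<Phi> P)) \<and>
        inj_on f (orbits (SO \<times>\<times> SO) ?H act33)"
    by blast
  show "orbit_space SO \<mu>_zero act4 homeomorphic_space orbit_space S3 UNIV perm_act"
    by (rule homeomorphic_space_trans[OF orbit_space_\<mu>_zero_homeomorphic])
      (rule homeomorphic_space_sym[THEN iffD1, OF orbit_space_S3_homeomorphic])
qed

end
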